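(* Let $X_1,X_2,\ldots$ be iid random variables with values in the ordered finite alphabet $\{\alpha_1<\cdots<\alpha_m\}$ with $\mathbb{P}(X_1=\alpha_r)=p_r$, $0<p_r<1$, $\sum_{r=1}^m p_r=1$, and let $p_{max}=\max_{1\le r\le m}p_r$. Let $LI_n$ be the length of the longest increasing subsequence of $X_1,\ldots,X_n$. Suppose that $p_{max}=p_{j_1}=p_{j_2}=\cdots=p_{j_k}$ for $1\le j_1<j_2<\cdots<j_k\le m$, for some $1\le k\le m-1$, and that $p_i<p_{max}$ otherwise. Then, as $n\to\infty$, $$\frac{LI_n-p_{max}n}{\sqrt n}\ \Rightarrow\ \sqrt{p_{max}(1-p_{max})}\ \max_{0=t_0\le t_1\le\cdots\le t_{k-1}\le t_k=1}\ \sum_{\ell=1}^k\left[\tilde B^\ell(t_\ell)-\tilde B^\ell(t_{\ell-1})\right],$$ where $(\tilde B^1(t),\tilde B^2(t),\dots,\tilde B^k(t))$, $0\le t\le1$, is a $k$-dimensional Brownian motion with covariance matrix $tM$, where $M$ is the $k\times k$ matrix with all diagonal entries equal to $1$ and all off-diagonal entries equal to $\rho=-p_{max}/(1-p_{max})$.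
   Context: Increasing subsequences are understood in the weak (nondecreasing) sense: $LI_n$ is the largest $\ell$ for which there are indices $1\le i_1<\cdots<i_\ell\le n$ with $X_{i_1}\le\cdots\le X_{i_\ell}$. The symbol $\Rightarrow$ denotes convergence in distribution. A $d$-dimensional Brownian motion is a linear transformation of a standard multidimensional Brownian motion on $[0,1]$ started at $0$; saying it has covariance matrix $tM$ means that it is a centered Gaussian process with continuous paths and stationary independent increments whose value at time $t$ has covariance matrix $tM$. *)

theory Defs
  imports "HOL-Probability.Probability"
begin

definition LI :: "(nat \<Rightarrow> 'b::linorder) \<Rightarrow> nat \<Rightarrow> nat" where
  "LI x n = Max {len. \<exists>i :: nat \<Rightarrow> nat. strict_mono_on {1..len} i \<and> i ` {1..len} \<subseteq> {1..n} \<and>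
                        mono_on {1..len} (\<lambda>r. x (i r))}"

(* Constant random variables count as Gaussian, with variance 0: the value of the process at
   time 0, or linear combinations under a singular covariance matrix, are of this kind. *)
definition gaussian_rv :: "'w measure \<Rightarrow> ('w \<Rightarrow> real) \<Rightarrow> bool" where
  "gaussian_rv N Y \<longleftrightarrow> Y \<in> borel_measurable N \<and>
     ((\<exists>\<mu>. distr N borel Y = return borel \<mu>) \<or>
      (\<exists>\<mu> \<sigma>. \<sigma> > 0 \<and> distr N borel Y = density lborel (normal_density \<mu> \<sigma>)))"

definition covariance :: "'w measure \<Rightarrow> ('w \<Rightarrow> real) \<Rightarrow> ('w \<Rightarrow> real) \<Rightarrow> real" where
  "covariance N Y Z =
     (LINT \<omega>|N. (Y \<omega> - (LINT \<omega>'|N. Y \<omega>')) * (Z \<omega> - (LINT \<omega>'|N. Z \<omega>')))"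

(* A k-dimensional process on [0,1] is given by its coordinates B l t for l in {1..k}; this is its
   increment over [s,t], as a random vector. *)
definition increment :: "nat \<Rightarrow> (nat \<Rightarrow> real \<Rightarrow> 'w \<Rightarrow> real) \<Rightarrow> real \<Rightarrow> real \<Rightarrow> 'w \<Rightarrow> nat \<Rightarrow> real" where
  "increment k B s t \<omega> = (\<lambda>l\<in>{1..k}. B l t \<omega> - B l s \<omega>)"

(* Being a Gaussian process means that all linear combinations of the finitely many real random
   variables B l t (l in {1..k}, t in T) are Gaussian. *)
definition brownian_motion ::
    "'w measure \<Rightarrow> nat \<Rightarrow> (nat \<Rightarrow> nat \<Rightarrow> real) \<Rightarrow> (nat \<Rightarrow> real \<Rightarrow> 'w \<Rightarrow> real) \<Rightarrow> bool" where
  "brownian_motion N k C B \<longleftrightarrow>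
     prob_space N \<and>
     (\<forall>l\<in>{1..k}. \<forall>\<omega>\<in>space N. B l 0 \<omega> = 0) \<and>
     (\<forall>l\<in>{1..k}. \<forall>\<omega>\<in>space N. continuous_on {0..1} (\<lambda>t. B l t \<omega>)) \<and>
     (\<forall>T c. finite T \<and> T \<subseteq> {0..1} \<longrightarrow>
        gaussian_rv N (\<lambda>\<omega>. \<Sum>l\<in>{1..k}. \<Sum>t\<in>T. c l t * B l t \<omega>)) \<and>
     (\<forall>l\<in>{1..k}. \<forall>t\<in>{0..1}. (LINT \<omega>|N. B l t \<omega>) = 0) \<and>
     (\<forall>(n::nat) \<tau>. mono_on {0..n} \<tau> \<and> \<tau> ` {0..n} \<subseteq> {0..1} \<longrightarrow>
        prob_space.indep_vars N (\<lambda>_. \<Pi>\<^sub>M l\<in>{1..k}. borel)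
          (\<lambda>i. increment k B (\<tau> (i - 1)) (\<tau> i)) {1..n}) \<and>
     (\<forall>s h. 0 \<le> s \<and> 0 \<le> h \<and> s + h \<le> 1 \<longrightarrow>
        distr N (\<Pi>\<^sub>M l\<in>{1..k}. borel) (increment k B s (s + h)) =
        distr N (\<Pi>\<^sub>M l\<in>{1..k}. borel) (increment k B 0 h)) \<and>
     (\<forall>t\<in>{0..1}. \<forall>l\<in>{1..k}. \<forall>l'\<in>{1..k}. covariance N (B l t) (B l' t) = t * C l l')"

definition partitions :: "nat \<Rightarrow> (nat \<Rightarrow> real) set" where
  "partitions k = {t. t 0 = 0 \<and> t k = 1 \<and> mono_on {0..k} t}"

definition max_functional :: "nat \<Rightarrow> (nat \<Rightarrow> real \<Rightarrow> real) \<Rightarrow> real" where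
  "max_functional k b = (SUP t\<in>partitions k. \<Sum>l=1..k. b l (t l) - b l (t (l - 1)))"

(* The supremum above is a maximum. *)
lemma max_functional_attained:
  assumes k: "1 \<le> k" and b: "\<And>l. l \<in> {1..k} \<Longrightarrow> continuous_on {0..1} (b l)"
  shows "\<exists>t\<in>partitions k. max_functional k b = (\<Sum>l=1..k. b l (t l) - b l (t (l - 1))) \<and>
           (\<forall>s\<in>partitions k. (\<Sum>l=1..k. b l (s l) - b l (s (l - 1)))
                            \<le> (\<Sum>l=1..k. b l (t l) - b l (t (l - 1))))"
proof -
  let ?f = "\<lambda>t. \<Sum>l=1..k. b l (t l) - b l (t (l - 1))"
  define S where "S = (UNIV \<rightarrow>\<^sub>E {0..1::real}) \<inter>
    ({t. t 0 = 0} \<inter> {t. t k = 1} \<inter> (\<Inter>l\<in>{0..k}. \<Inter>l'\<in>{l..k}. {t :: nat \<Rightarrow> real. t l \<le> t l'}))"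
  have "compact (UNIV \<rightarrow>\<^sub>E {0..1::real} :: (nat \<Rightarrow> real) set)"
    by (subst compactin_euclidean_iff[symmetric], subst euclidean_product_topology[symmetric])
       (auto simp: compactin_PiE)
  then have comp: "compact S"
    unfolding S_def
    by (intro compact_Int_closed closed_Int closed_INT ballI closed_Collect_le closed_Collect_eq
          continuous_on_product_coordinates continuous_on_const)
  have S_part: "S \<subseteq> partitions k"
    by (auto simp: S_def partitions_def mono_on_def)
  have trunc: "(\<lambda>l. if l \<le> k then t l else 0) \<in> S \<and> ?f (\<lambda>l. if l \<le> k then t l else 0) = ?f t"
    if "t \<in> partitions k" for t
  proof -
    have t: "t 0 = 0" "t k = 1" and m: "\<And>i j. i \<le> j \<Longrightarrow> j \<le> k \<Longrightarrow> t i \<le> t j"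
      using that by (auto simp: partitions_def mono_on_def)
    have "0 \<le> t l \<and> t l \<le> 1" if "l \<le> k" for l
      using m[of 0 l] m[of l k] t that by auto
    then have "(\<lambda>l. if l \<le> k then t l else 0) \<in> S"
      using t m by (auto simp: S_def)
    moreover have "?f (\<lambda>l. if l \<le> k then t l else 0) = ?f t"
      by (intro sum.cong) auto
    ultimately show ?thesis by blast
  qed
  have "(\<lambda>l. if l \<le> k then if l = 0 then 0 else 1 else 0) \<in> S"
    using k by (auto simp: S_def)
  then have ne: "S \<noteq> {}" by blast
  have "continuous_on S (\<lambda>t. b l (t j))" if "l \<in> {1..k}" for l j
    by (rule continuous_on_compose2[OF b[OF that]])
       (auto simp: S_def intro: continuous_on_subset[OF continuous_on_product_coordinates])
  then have "continuous_on S ?f"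
    by (intro continuous_on_sum continuous_on_diff) auto
  from continuous_attains_sup[OF comp ne this]
  obtain t where t: "t \<in> S" "\<And>s. s \<in> S \<Longrightarrow> ?f s \<le> ?f t"
    by (elim bexE) (rule that, assumption, drule (1) bspec)
  have ub: "?f s \<le> ?f t" if "s \<in> partitions k" for s
    using t(2)[of "\<lambda>l. if l \<le> k then s l else 0"] trunc[OF that] by linarith
  have "max_functional k b = ?f t"
    unfolding max_functional_def using t(1) S_part ub by (intro cSup_eq_maximum) auto
  then show ?thesis
    using t(1) S_part ub by (intro bexI[of _ t] conjI ballI) auto
qed

end

theory Submission
  imports Defs "HOL-Real_Asymp.Real_Asymp"
begin

text \<open>
  A nondecreasing subsequence splits the index range into consecutive blocks, one for each letter, and
  takes the occurrences of that letter in its block. So, up to letters of smaller probability, the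
  longest increasing subsequence maximises, over the integer partitions of the index range into \<open>k\<close>
  segments, the number of indices whose letter is the one assigned to their segment. After centering,
  this is a maximum over paths of sums of steps: the path picks, at each index, one coordinate of a
  \<open>k\<close>-dimensional vector, and these vectors are iid with mean zero. The Brownian functional,
  restricted to partitions with breakpoints in the multiples of \<open>1 / n\<close>, is literally the same maximum,
  evaluated at the increments of the Brownian motion over the intervals of length \<open>1 / n\<close>, and these
  increments have the same mean and covariance as the normalised letter vectors.

  The two maxima, both over all paths with \<open>n\<close> steps, are compared directly by Lindeberg's replacement of one step at a time
  (\<open>lindeberg_exchange\<close>). The maximum is not smooth, so it is first replaced by the log-sum-exp function
  with parameter \<open>\<beta>\<close>. This costs \<open>ln (number of paths) / \<beta> = O(ln n / \<beta>)\<close>, because there are only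
  polynomially many partitions. The third derivative of a bounded trigonometric function of the
  log-sum-exp function is of order \<open>\<beta>\<^sup>2\<close> (\<open>sin_log_sum_exp_taylor\<close>). One replacement therefore costs
  \<open>O(\<beta>\<^sup>2 n powr (- 3 / 2))\<close>, since first and second moments agree, and all \<open>n\<close> of them cost
  \<open>O(\<beta>\<^sup>2 / sqrt n)\<close>. With \<open>\<beta> = n powr (1 / 8)\<close> both errors vanish (\<open>max_path_comparison\<close>).

  Two facts remain. Letters of smaller probability change the length by only \<open>O(ln n)\<close> in expectation
  (\<open>expectation_LI_minus_segment_matches\<close>): using such a letter \<open>a\<close> on a block instead of a most
  probable letter pays off only if \<open>a\<close> is more frequent there, the excess of its count is a random walk
  with negative drift, and at a suitable rate its exponential has expectation exactly \<open>1\<close>. And the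
  discretised Brownian functional converges pathwise to the full one, by continuity of paths at one
  maximising partition (\<open>grid_max_tendsto_max_functional\<close>). Together this gives convergence of the
  expectations of \<open>sin (t y + c)\<close> for all \<open>t\<close> and \<open>c\<close>, that is, of the characteristic functions, and
  Levy's continuity theorem finishes the proof.
\<close>

section \<open>Replacing the steps of a maximal path sum one at a time\<close>

text \<open>
  The hybrid products, with law \<open>P\<close> on the first \<open>s\<close> coordinates and \<open>Q\<close> on the others, interpolate
  between the two products. Neighbouring hybrids agree away from coordinate \<open>s\<close>, so by Fubini their
  difference is an average of one-coordinate differences.
\<close>
lemma lindeberg_exchange:
  fixes P Q :: "'v measure" and h :: "(nat \<Rightarrow> 'v) \<Rightarrow> real"
  assumes P: "prob_space P" and Q: "prob_space Q" and sets: "sets Q = sets P"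
    and h: "h \<in> borel_measurable (\<Pi>\<^sub>M i\<in>{1..n}. P)" and bdd: "\<And>x. \<bar>h x\<bar> \<le> C"
    and swap: "\<And>s x. s \<in> {1..n} \<Longrightarrow>
      \<bar>(LINT y|P. h (x(s := y))) - (LINT y|Q. h (x(s := y)))\<bar> \<le> \<epsilon>"
  shows "\<bar>(LINT x|(\<Pi>\<^sub>M i\<in>{1..n}. P). h x) - (LINT x|(\<Pi>\<^sub>M i\<in>{1..n}. Q). h x)\<bar> \<le> real n * \<epsilon>"
proof -
  define R where "R s i = (if i \<le> s then P else Q)" for s i :: nat
  have R: "prob_space (R s i)" for s i
    using P Q by (simp add: R_def)
  have setsR: "sets (\<Pi>\<^sub>M i\<in>J. R s i) = sets (\<Pi>\<^sub>M i\<in>J. P)" for s J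
    by (intro sets_PiM_cong) (auto simp: R_def sets)
  have spaceR: "space (\<Pi>\<^sub>M i\<in>J. R s i) = space (\<Pi>\<^sub>M i\<in>J. P)" for s J
    using setsR by (rule sets_eq_imp_space_eq)
  have hR: "integrable (\<Pi>\<^sub>M i\<in>{1..n}. R s i) h" for s
  proof -
    interpret prob_space "\<Pi>\<^sub>M i\<in>{1..n}. R s i"
      using R by (intro prob_space_PiM)
    show ?thesis
      using h bdd by (intro integrable_const_bound[where B=C]) (auto simp: measurable_cong_sets[OF setsR refl])
  qed
  have step: "\<bar>(LINT x|(\<Pi>\<^sub>M i\<in>{1..n}. R s i). h x) - (LINT x|(\<Pi>\<^sub>M i\<in>{1..n}. R (s - 1) i). h x)\<bar> \<le> \<epsilon>"
    if s: "s \<in> {1..n}" for s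
  proof -
    define J where "J = {1..n} - {s}"
    have ins: "{1..n} = insert s J" "s \<notin> J" "finite J"
      using s by (auto simp: J_def)
    let ?J = "\<Pi>\<^sub>M i\<in>J. R s i"
    have eqJ: "(\<Pi>\<^sub>M i\<in>J. R (s - 1) i) = ?J"
      using s by (intro PiM_cong) (auto simp: R_def J_def)
    interpret J: prob_space ?J
      using R by (intro prob_space_PiM)
    have fold: "(LINT x|(\<Pi>\<^sub>M i\<in>{1..n}. R s' i). h x) = (LINT x|(\<Pi>\<^sub>M i\<in>J. R s' i). LINT y|R s' s. h (x(s := y)))" for s'
    proof -
      interpret product_prob_space "R s'" using R by (rule product_prob_spaceI)
      show ?thesis
        using hR[of s'] unfolding ins(1) by (intro product_integral_insert ins(2,3))
    qed
    have int: "integrable ?J (\<lambda>x. LINT y|R'. h (x(s := y)))" if R': "R' = P \<or> R' = Q" for R'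
    proof (rule J.integrable_const_bound[where B=C])
      interpret R': prob_space R' using R' P Q by auto
      have up: "(\<lambda>(x, y). x(s := y)) \<in> measurable (?J \<Otimes>\<^sub>M R') (\<Pi>\<^sub>M i\<in>{1..n}. P)"
      proof -
        have "(\<lambda>(x, y). x(s := y)) \<in> measurable ((\<Pi>\<^sub>M i\<in>J. P) \<Otimes>\<^sub>M P) (\<Pi>\<^sub>M i\<in>insert s J. P)"
          by (rule measurable_add_dim)
        moreover have "sets (?J \<Otimes>\<^sub>M R') = sets ((\<Pi>\<^sub>M i\<in>J. P) \<Otimes>\<^sub>M P)"
          using R' sets by (intro sets_pair_measure_cong setsR) auto
        ultimately show ?thesis
          unfolding ins(1) by (simp cong: measurable_cong_sets)
      qed
      have "(\<lambda>(x, y). h (x(s := y))) \<in> borel_measurable (?J \<Otimes>\<^sub>M R')"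
        using measurable_compose[OF up h] by (simp add: split_beta')
      then show "(\<lambda>x. LINT y|R'. h (x(s := y))) \<in> borel_measurable ?J"
        by (rule R'.borel_measurable_lebesgue_integral)
      have "\<bar>LINT y|R'. h (x(s := y))\<bar> \<le> C" for x
      proof (cases "integrable R' (\<lambda>y. h (x(s := y)))")
        case True
        then have "\<bar>LINT y|R'. h (x(s := y))\<bar> \<le> (LINT y|R'. C)"
          using bdd by (intro order.trans[OF integral_abs_bound] integral_mono) auto
        then show ?thesis by (simp add: R'.prob_space)
      next
        case False
        then show ?thesis using bdd[of undefined] by (simp add: not_integrable_integral_eq)
      qed
      then show "AE x in ?J. norm (LINT y|R'. h (x(s := y))) \<le> C" by simp
    qed
    have "(LINT x|(\<Pi>\<^sub>M i\<in>{1..n}. R s i). h x) - (LINT x|(\<Pi>\<^sub>M i\<in>{1..n}. R (s - 1) i). h x) =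
        (LINT x|?J. (LINT y|P. h (x(s := y))) - (LINT y|Q. h (x(s := y))))"
      using s unfolding fold eqJ
      by (subst Bochner_Integration.integral_diff) (auto simp: int R_def)
    also have "\<bar>\<dots>\<bar> \<le> (LINT x|?J. \<epsilon>)"
      using int swap[OF s] by (intro order.trans[OF integral_abs_bound] integral_mono) auto
    finally show ?thesis by (simp add: J.prob_space)
  qed
  have "\<bar>(LINT x|(\<Pi>\<^sub>M i\<in>{1..n}. R n i). h x) - (LINT x|(\<Pi>\<^sub>M i\<in>{1..n}. R 0 i). h x)\<bar> =
    \<bar>\<Sum>s=1..n. (LINT x|(\<Pi>\<^sub>M i\<in>{1..n}. R s i). h x) - (LINT x|(\<Pi>\<^sub>M i\<in>{1..n}. R (s - 1) i). h x)\<bar>"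
    using sum_telescope''[of 0 n "\<lambda>s. LINT x|(\<Pi>\<^sub>M i\<in>{1..n}. R s i). h x"] by simp
  also have "\<dots> \<le> (\<Sum>s=1..n. \<epsilon>)"
    using step by (intro order.trans[OF sum_abs] sum_mono) auto
  also have "(\<Pi>\<^sub>M i\<in>{1..n}. R n i) = (\<Pi>\<^sub>M i\<in>{1..n}. P)"
    by (intro PiM_cong) (auto simp: R_def)
  also have "(\<Pi>\<^sub>M i\<in>{1..n}. R 0 i) = (\<Pi>\<^sub>M i\<in>{1..n}. Q)"
    by (intro PiM_cong) (auto simp: R_def)
  finally show ?thesis by simp
qed

lemma convex_combination_abs_le:
  fixes q x :: "'l \<Rightarrow> real"
  assumes "\<And>l. l \<in> L \<Longrightarrow> 0 \<le> q l" and "(\<Sum>l\<in>L. q l) = 1" and "\<And>l. l \<in> L \<Longrightarrow> \<bar>x l\<bar> \<le> R"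
  shows "\<bar>\<Sum>l\<in>L. q l * x l\<bar> \<le> R"
proof -
  have "\<bar>\<Sum>l\<in>L. q l * x l\<bar> \<le> (\<Sum>l\<in>L. q l * R)"
    using assms by (intro order.trans[OF sum_abs] sum_mono) (auto simp: abs_mult intro: mult_left_mono)
  also have "\<dots> = R" using assms(2) by (simp flip: sum_distrib_right)
  finally show ?thesis .
qed

text \<open>
  Along the ray \<open>s \<mapsto> s x\<close> the derivatives of the log-sum-exp function are powers of \<open>\<beta>\<close> times cumulants
  of \<open>x\<close> under the tilted weights \<open>A l exp (\<beta> s x l)\<close>. Cumulants of order \<open>j\<close> are bounded by a multiple
  of \<open>R\<^sup>j\<close> whatever the weights are, so the remainder bound does not depend on \<open>A\<close>. This uniformity is
  what lets the estimate be used conditionally on all the other steps.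
\<close>
lemma sin_log_sum_exp_taylor:
  fixes A x :: "'l \<Rightarrow> real" and t c :: real
  assumes L: "finite L" and A: "\<And>l. l \<in> L \<Longrightarrow> 0 \<le> A l" and pos: "0 < (\<Sum>l\<in>L. A l)" and \<beta>: "0 < \<beta>"
    and x: "\<And>l. l \<in> L \<Longrightarrow> \<bar>x l\<bar> \<le> R"
  defines "q \<equiv> \<lambda>l. A l / (\<Sum>l\<in>L. A l)"
  defines "\<theta> \<equiv> t / \<beta> * ln (\<Sum>l\<in>L. A l) + c"
  shows "\<bar>sin (t / \<beta> * ln (\<Sum>l\<in>L. A l * exp (\<beta> * x l)) + c) -
     (sin \<theta> + t * cos \<theta> * (\<Sum>l\<in>L. q l * x l)
        + (t * \<beta> * ((\<Sum>l\<in>L. q l * x l ^ 2) - (\<Sum>l\<in>L. q l * x l)\<^sup>2) * cos \<theta>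
            - t\<^sup>2 * (\<Sum>l\<in>L. q l * x l)\<^sup>2 * sin \<theta>) / 2)\<bar>
    \<le> (\<bar>t\<bar> * \<beta>\<^sup>2 + t\<^sup>2 * \<beta> + \<bar>t\<bar> ^ 3) * R ^ 3"
proof -
  \<comment> \<open>The quotients \<open>m j = Z j / Z 0\<close> below are the moments of \<open>x\<close> under the tilted weights.\<close>
  define Z where "Z j s = (\<Sum>l\<in>L. A l * x l ^ j * exp (\<beta> * s * x l))" for j :: nat and s :: real
  have Z: "(Z j has_real_derivative \<beta> * Z (Suc j) s) (at s)" for j s
    unfolding Z_def[abs_def]
    by (auto intro!: derivative_eq_intros sum.cong simp: sum_distrib_left)
  have Z0: "0 < Z 0 s" for s
  proof -
    obtain l where l: "l \<in> L" "A l \<noteq> 0" using pos by (metis less_irrefl sum.neutral)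
    then have "0 < A l * exp (\<beta> * s * x l)" using A by (simp add: less_le)
    also have "\<dots> \<le> Z 0 s"
      unfolding Z_def using A l(1) L by (simp, intro member_le_sum) auto
    finally show ?thesis .
  qed
  define m where "m j s = Z j s / Z 0 s" for j s
  have m: "(m j has_real_derivative \<beta> * (m (Suc j) s - m j s * m 1 s)) (at s)" for j s
    unfolding m_def[abs_def]
    by (rule derivative_eq_intros Z | use Z0[of s] in \<open>simp add: field_simps\<close>)+
  have m_bound: "\<bar>m j s\<bar> \<le> R ^ j" for j s
  proof -
    have "m j s = (\<Sum>l\<in>L. A l * exp (\<beta> * s * x l) / Z 0 s * x l ^ j)"
      by (simp add: m_def Z_def sum_divide_distrib mult_ac)
    also have "\<bar>\<dots>\<bar> \<le> R ^ j"
    proof (rule convex_combination_abs_le)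
      show "(\<Sum>l\<in>L. A l * exp (\<beta> * s * x l) / Z 0 s) = 1"
        using Z0[of s] by (simp add: Z_def flip: sum_divide_distrib)
    qed (use A Z0[of s] x in \<open>auto simp: power_abs intro: power_mono\<close>)
    finally show ?thesis .
  qed
  define \<Theta> where "\<Theta> s = t / \<beta> * ln (Z 0 s) + c" for s
  have \<Theta>: "(\<Theta> has_real_derivative t * m 1 s) (at s)" for s
    unfolding \<Theta>_def[abs_def] using Z0[of s] \<beta>
    by (auto intro!: derivative_eq_intros Z simp: m_def field_simps)
  define d1 where "d1 s = t * m 1 s * cos (\<Theta> s)" for s
  define d2 where "d2 s = t * \<beta> * (m 2 s - (m 1 s)\<^sup>2) * cos (\<Theta> s) - t\<^sup>2 * (m 1 s)\<^sup>2 * sin (\<Theta> s)" for s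
  define d3 where "d3 s = t * \<beta>\<^sup>2 * (m 3 s - m 2 s * m 1 s - 2 * m 1 s * (m 2 s - (m 1 s)\<^sup>2)) * cos (\<Theta> s)
    - 3 * t\<^sup>2 * \<beta> * m 1 s * (m 2 s - (m 1 s)\<^sup>2) * sin (\<Theta> s) - t ^ 3 * (m 1 s) ^ 3 * cos (\<Theta> s)" for s
  have D: "((\<lambda>s. sin (\<Theta> s)) has_real_derivative d1 s) (at s)"
    "(d1 has_real_derivative d2 s) (at s)" "(d2 has_real_derivative d3 s) (at s)" for s
  proof -
    have m1: "(m 1 has_real_derivative \<beta> * (m 2 s - (m 1 s)\<^sup>2)) (at s)"
      using m[of 1 s] by (simp add: numeral_2_eq_2 power2_eq_square)
    have m2: "(m 2 has_real_derivative \<beta> * (m 3 s - m 2 s * m 1 s)) (at s)"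
      using m[of 2 s] by (simp add: numeral_3_eq_3 numeral_2_eq_2)
    show "((\<lambda>s. sin (\<Theta> s)) has_real_derivative d1 s) (at s)"
      unfolding d1_def by (auto intro!: derivative_eq_intros \<Theta>)
    show "(d1 has_real_derivative d2 s) (at s)"
      unfolding d1_def[abs_def] d2_def
      by (rule derivative_eq_intros \<Theta> m1 refl)+ (simp add: algebra_simps power2_eq_square)
    show "(d2 has_real_derivative d3 s) (at s)"
      unfolding d2_def[abs_def] d3_def
      by (rule derivative_eq_intros \<Theta> m1 m2 refl)+ (simp add: algebra_simps power2_eq_square power3_eq_cube)
  qed
  have "\<exists>s>0. s < 1 \<and> sin (\<Theta> 1) = (\<Sum>j<3. (\<lambda>j. [\<lambda>s. sin (\<Theta> s), d1, d2, d3] ! j) j 0 / fact j * 1 ^ j)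
      + (\<lambda>j. [\<lambda>s. sin (\<Theta> s), d1, d2, d3] ! j) 3 s / fact 3 * 1 ^ 3"
    by (rule Maclaurin) (auto simp: less_Suc_eq numeral_3_eq_3 D)
  then obtain s where s: "sin (\<Theta> 1) = sin (\<Theta> 0) + d1 0 + d2 0 / 2 + d3 s / 6"
    by (auto simp: eval_nat_numeral)
  have R0: "0 \<le> R" using m_bound[of 1 s] by simp
  have m': "\<bar>m 1 s\<bar> \<le> R" "\<bar>m 2 s\<bar> \<le> R\<^sup>2" "\<bar>m 3 s\<bar> \<le> R ^ 3"
    using m_bound[of 1 s] m_bound[of 2 s] m_bound[of 3 s] by simp_all
  have m11: "\<bar>(m 1 s)\<^sup>2\<bar> \<le> R\<^sup>2" and m111: "\<bar>(m 1 s) ^ 3\<bar> \<le> R ^ 3"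
    using power_mono[OF m'(1), of 2] power_mono[OF m'(1), of 3] by (simp_all add: power_abs)
  have var: "\<bar>m 2 s - (m 1 s)\<^sup>2\<bar> \<le> 2 * R\<^sup>2"
    using m'(2) m11 by linarith
  have m1var: "\<bar>m 1 s * (m 2 s - (m 1 s)\<^sup>2)\<bar> \<le> 2 * R ^ 3"
    using mult_mono[OF m'(1) var] R0 by (simp add: abs_mult power3_eq_cube power2_eq_square)
  have m21: "\<bar>m 2 s * m 1 s\<bar> \<le> R ^ 3"
    using mult_mono[OF m'(2,1)] R0 by (simp add: abs_mult power3_eq_cube power2_eq_square)
  \<comment> \<open>the third cumulant\<close>
  have cumulant: "\<bar>m 3 s - m 2 s * m 1 s - 2 * m 1 s * (m 2 s - (m 1 s)\<^sup>2)\<bar> \<le> 6 * R ^ 3"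
    using m'(3) m1var m21 by linarith
  have trig: "\<bar>a * u * v\<bar> \<le> b * w" if "\<bar>a\<bar> \<le> b" "\<bar>u\<bar> \<le> w" "\<bar>v\<bar> \<le> 1" for a b u v w :: real
    using mult_mono[OF mult_mono[OF that(1,2)] that(3)] that by (auto simp: abs_mult)
  have "\<bar>d3 s\<bar> \<le> \<bar>t * \<beta>\<^sup>2\<bar> * (6 * R ^ 3) + \<bar>3 * t\<^sup>2 * \<beta>\<bar> * (2 * R ^ 3) + \<bar>t ^ 3\<bar> * R ^ 3"
    using trig[OF order.refl cumulant abs_cos_le_one, of "t * \<beta>\<^sup>2" "\<Theta> s"]
      trig[OF order.refl m1var abs_sin_le_one, of "3 * t\<^sup>2 * \<beta>" "\<Theta> s"]
      trig[OF order.refl m111 abs_cos_le_one, of "t ^ 3" "\<Theta> s"]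
    unfolding d3_def mult.assoc by linarith
  then have "\<bar>d3 s\<bar> \<le> (6 * \<bar>t\<bar> * \<beta>\<^sup>2 + 6 * t\<^sup>2 * \<beta> + \<bar>t\<bar> ^ 3) * R ^ 3"
    using \<beta> by (simp add: abs_mult power_abs algebra_simps)
  moreover have "0 \<le> \<bar>t\<bar> ^ 3 * R ^ 3"
    using R0 by simp
  ultimately have "\<bar>d3 s / 6\<bar> \<le> (\<bar>t\<bar> * \<beta>\<^sup>2 + t\<^sup>2 * \<beta> + \<bar>t\<bar> ^ 3) * R ^ 3"
    by (simp add: algebra_simps)
  moreover have "\<Theta> 0 = \<theta>" "\<Theta> 1 = t / \<beta> * ln (\<Sum>l\<in>L. A l * exp (\<beta> * x l)) + c"
    by (simp_all add: \<Theta>_def \<theta>_def Z_def)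
  moreover have "m j 0 = (\<Sum>l\<in>L. q l * x l ^ j)" for j
    by (simp add: m_def Z_def q_def sum_divide_distrib)
  ultimately show ?thesis
    using s by (simp add: d1_def d2_def mult_ac)
qed

text \<open>
  The second-order Taylor polynomial at \<open>0\<close> is a quadratic polynomial in the coordinates of the step, so
  its expectation depends on the law only through the means and the second moments, which agree.
  Only the two third-order remainders are left.
\<close>
lemma sin_log_sum_exp_swap:
  fixes P Q :: "('l \<Rightarrow> real) measure" and A :: "'l \<Rightarrow> real" and t c :: real
  assumes L: "finite L"
    and P: "prob_space P" "sets P = sets (\<Pi>\<^sub>M l\<in>L. borel)"
    and Q: "prob_space Q" "sets Q = sets (\<Pi>\<^sub>M l\<in>L. borel)"
    and third: "\<And>l. l \<in> L \<Longrightarrow> integrable P (\<lambda>x. \<bar>x l\<bar> ^ 3)" "\<And>l. l \<in> L \<Longrightarrow> integrable Q (\<lambda>x. \<bar>x l\<bar> ^ 3)"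
    and mean: "\<And>l. l \<in> L \<Longrightarrow> (LINT x|P. x l) = (LINT x|Q. x l)"
    and second: "\<And>l l'. l \<in> L \<Longrightarrow> l' \<in> L \<Longrightarrow> (LINT x|P. x l * x l') = (LINT x|Q. x l * x l')"
    and \<tau>: "(\<Sum>l\<in>L. LINT x|P. \<bar>x l\<bar> ^ 3) + (\<Sum>l\<in>L. LINT x|Q. \<bar>x l\<bar> ^ 3) \<le> \<tau>"
    and A: "\<And>l. l \<in> L \<Longrightarrow> 0 \<le> A l" and pos: "0 < (\<Sum>l\<in>L. A l)" and \<beta>: "0 < \<beta>"
  defines "f \<equiv> \<lambda>x. sin (t / \<beta> * ln (\<Sum>l\<in>L. A l * exp (\<beta> * x l)) + c)"
  shows "\<bar>(LINT x|P. f x) - (LINT x|Q. f x)\<bar> \<le> (\<bar>t\<bar> * \<beta>\<^sup>2 + t\<^sup>2 * \<beta> + \<bar>t\<bar> ^ 3) * \<tau>"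
proof -
  define K where "K = \<bar>t\<bar> * \<beta>\<^sup>2 + t\<^sup>2 * \<beta> + \<bar>t\<bar> ^ 3"
  have K: "0 \<le> K" using \<beta> by (simp add: K_def)
  define q where "q l = A l / (\<Sum>l\<in>L. A l)" for l
  define \<theta> where "\<theta> = t / \<beta> * ln (\<Sum>l\<in>L. A l) + c"
  define T where "T x = sin \<theta> + t * cos \<theta> * (\<Sum>l\<in>L. q l * x l)
        + (t * \<beta> * ((\<Sum>l\<in>L. q l * x l ^ 2) - (\<Sum>l\<in>L. q l * x l)\<^sup>2) * cos \<theta>
            - t\<^sup>2 * (\<Sum>l\<in>L. q l * x l)\<^sup>2 * sin \<theta>) / 2" for x :: "'l \<Rightarrow> real"
  have T_expand: "T x = sin \<theta> + t * cos \<theta> * (\<Sum>l\<in>L. q l * x l)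
        + (t * \<beta> * cos \<theta> * (\<Sum>l\<in>L. q l * (x l * x l))
            - (t * \<beta> * cos \<theta> + t\<^sup>2 * sin \<theta>) * (\<Sum>l\<in>L. \<Sum>l'\<in>L. q l * q l' * (x l * x l'))) / 2" for x
    unfolding T_def by (simp add: power2_eq_square sum_product algebra_simps)
  have taylor: "\<bar>f x - T x\<bar> \<le> K * (\<Sum>l\<in>L. \<bar>x l\<bar> ^ 3)" for x
  proof -
    have "L \<noteq> {}" using pos by auto
    then have "Max ((\<lambda>l. \<bar>x l\<bar>) ` L) \<in> (\<lambda>l. \<bar>x l\<bar>) ` L"
      using L by (intro Max_in) auto
    then obtain l where l: "l \<in> L" "Max ((\<lambda>l. \<bar>x l\<bar>) ` L) = \<bar>x l\<bar>" by auto
    have "\<bar>x l'\<bar> \<le> \<bar>x l\<bar>" if "l' \<in> L" for l'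
      using that L by (subst l(2)[symmetric]) auto
    then have "\<bar>f x - T x\<bar> \<le> K * \<bar>x l\<bar> ^ 3"
      unfolding f_def T_def K_def q_def \<theta>_def
      by (intro sin_log_sum_exp_taylor L A pos \<beta>)
    also have "\<bar>x l\<bar> ^ 3 \<le> (\<Sum>l\<in>L. \<bar>x l\<bar> ^ 3)"
      using L l(1) by (intro member_le_sum) auto
    finally show ?thesis using K by (simp add: mult_left_mono)
  qed
  have one: "(LINT x|R. f x) - (LINT x|R. T x) \<le> K * (\<Sum>l\<in>L. LINT x|R. \<bar>x l\<bar> ^ 3)"
      "(LINT x|R. T x) - (LINT x|R. f x) \<le> K * (\<Sum>l\<in>L. LINT x|R. \<bar>x l\<bar> ^ 3)"
      "(LINT x|R. T x) = sin \<theta> + t * cos \<theta> * (\<Sum>l\<in>L. q l * (LINT x|R. x l))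
        + (t * \<beta> * cos \<theta> * (\<Sum>l\<in>L. q l * (LINT x|R. x l * x l))
            - (t * \<beta> * cos \<theta> + t\<^sup>2 * sin \<theta>) * (\<Sum>l\<in>L. \<Sum>l'\<in>L. q l * q l' * (LINT x|R. x l * x l'))) / 2"
    if R: "prob_space R" "sets R = sets (\<Pi>\<^sub>M l\<in>L. borel)" "\<And>l. l \<in> L \<Longrightarrow> integrable R (\<lambda>x. \<bar>x l\<bar> ^ 3)"
    for R :: "('l \<Rightarrow> real) measure"
  proof -
    interpret R: prob_space R by fact
    have meas[measurable]: "(\<lambda>x. x l) \<in> borel_measurable R" if "l \<in> L" for l
      using that by (simp add: measurable_cong_sets[OF R(2) refl])
    have sq: "a\<^sup>2 \<le> 1 + \<bar>a\<bar> ^ 3" for a :: real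
    proof (cases "\<bar>a\<bar> \<le> 1")
      case True
      then have "a\<^sup>2 \<le> 1" by (simp add: abs_square_le_1)
      then show ?thesis by (simp add: add_increasing2)
    next
      case False
      then have "\<bar>a\<bar> ^ 2 \<le> \<bar>a\<bar> ^ 3" by (intro power_increasing) auto
      then show ?thesis by simp
    qed
    have "\<bar>a * b\<bar> \<le> a\<^sup>2 + b\<^sup>2" for a b :: real
      using sum_squares_bound[of a b] sum_squares_bound[of a "- b"] by (simp add: abs_if)
    then have ab: "\<bar>a * b\<bar> \<le> 2 + \<bar>a\<bar> ^ 3 + \<bar>b\<bar> ^ 3" for a b :: real
      using sq[of a] sq[of b] by (smt (verit))
    have i2: "integrable R (\<lambda>x. x l * x l')" if "l \<in> L" "l' \<in> L" for l l'
      by (rule Bochner_Integration.integrable_bound[where f="\<lambda>x. 2 + \<bar>x l\<bar> ^ 3 + \<bar>x l'\<bar> ^ 3"])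
        (use that R(3) ab in auto)
    have i1: "integrable R (\<lambda>x. x l)" if "l \<in> L" for l
      by (rule Bochner_Integration.integrable_bound[where f="\<lambda>x. 3 + \<bar>x l\<bar> ^ 3"])
        (use that R(3) ab[of _ 1] in auto)
    note ints = i1 i2 R(3)
    have iT: "integrable R T"
      unfolding T_expand[abs_def]
      by (intro Bochner_Integration.integrable_add Bochner_Integration.integrable_diff integrable_divide
          integrable_mult_right Bochner_Integration.integrable_sum ints R.integrable_const)
    show "(LINT x|R. T x) = sin \<theta> + t * cos \<theta> * (\<Sum>l\<in>L. q l * (LINT x|R. x l))
        + (t * \<beta> * cos \<theta> * (\<Sum>l\<in>L. q l * (LINT x|R. x l * x l))
            - (t * \<beta> * cos \<theta> + t\<^sup>2 * sin \<theta>) * (\<Sum>l\<in>L. \<Sum>l'\<in>L. q l * q l' * (LINT x|R. x l * x l'))) / 2"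
      unfolding T_expand by (simp add: ints R.prob_space)
    have "f \<in> borel_measurable R"
      unfolding f_def by measurable
    then have if': "integrable R f"
      by (intro R.integrable_const_bound[where B=1]) (auto simp: f_def)
    have "(LINT x|R. f x) - (LINT x|R. T x) = (LINT x|R. f x - T x)"
      using if' iT by simp
    also have "\<bar>\<dots>\<bar> \<le> (LINT x|R. K * (\<Sum>l\<in>L. \<bar>x l\<bar> ^ 3))"
      using if' iT taylor ints by (intro order.trans[OF integral_abs_bound] integral_mono) auto
    also have "\<dots> = K * (\<Sum>l\<in>L. LINT x|R. \<bar>x l\<bar> ^ 3)"
      using ints by simp
    finally show "(LINT x|R. f x) - (LINT x|R. T x) \<le> K * (\<Sum>l\<in>L. LINT x|R. \<bar>x l\<bar> ^ 3)"
      "(LINT x|R. T x) - (LINT x|R. f x) \<le> K * (\<Sum>l\<in>L. LINT x|R. \<bar>x l\<bar> ^ 3)"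
      by linarith+
  qed
  note oneP = one[OF P, OF third(1)] and oneQ = one[OF Q, OF third(2)]
  have "(LINT x|P. T x) = (LINT x|Q. T x)"
    by (subst oneP(3), assumption, subst oneQ(3), assumption) (simp add: mean second)
  moreover have "(LINT x|P. f x) - (LINT x|P. T x) \<le> K * (\<Sum>l\<in>L. LINT x|P. \<bar>x l\<bar> ^ 3)"
      "(LINT x|P. T x) - (LINT x|P. f x) \<le> K * (\<Sum>l\<in>L. LINT x|P. \<bar>x l\<bar> ^ 3)"
      "(LINT x|Q. f x) - (LINT x|Q. T x) \<le> K * (\<Sum>l\<in>L. LINT x|Q. \<bar>x l\<bar> ^ 3)"
      "(LINT x|Q. T x) - (LINT x|Q. f x) \<le> K * (\<Sum>l\<in>L. LINT x|Q. \<bar>x l\<bar> ^ 3)"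
    by (rule oneP oneQ, assumption)+
  ultimately have "\<bar>(LINT x|P. f x) - (LINT x|Q. f x)\<bar> \<le>
      K * (\<Sum>l\<in>L. LINT x|P. \<bar>x l\<bar> ^ 3) + K * (\<Sum>l\<in>L. LINT x|Q. \<bar>x l\<bar> ^ 3)"
    by linarith
  also have "\<dots> \<le> K * \<tau>"
    using K \<tau> by (simp flip: distrib_left add: mult_left_mono)
  finally show ?thesis by (simp add: K_def)
qed

lemma abs_sin_diff_le: "\<bar>sin x - sin y\<bar> \<le> \<bar>x - y\<bar>" for x y :: real
proof -
  have "\<bar>sin x - sin y\<bar> = 2 * \<bar>sin ((x - y) / 2)\<bar> * \<bar>cos ((x + y) / 2)\<bar>"
    by (simp add: sin_diff_sin abs_mult)
  also have "\<dots> \<le> 2 * \<bar>(x - y) / 2\<bar> * 1"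
    by (intro mult_mono abs_sin_x_le_abs_x) auto
  finally show ?thesis by simp
qed

lemma log_sum_exp_approx_Max:
  fixes a :: "'c \<Rightarrow> real"
  assumes "finite I" "I \<noteq> {}" "0 < \<beta>"
  shows "\<bar>ln (\<Sum>b\<in>I. exp (\<beta> * a b)) / \<beta> - Max (a ` I)\<bar> \<le> ln (card I) / \<beta>"
proof -
  have "Max (a ` I) \<in> a ` I" using assms by (intro Max_in) auto
  then obtain b where b: "b \<in> I" "Max (a ` I) = a b" by auto
  have le: "a b' \<le> a b" if "b' \<in> I" for b'
    using that assms by (subst b(2)[symmetric]) auto
  have lower: "exp (\<beta> * a b) \<le> (\<Sum>b\<in>I. exp (\<beta> * a b))"
    using assms b(1) by (intro member_le_sum) auto
  then have pos: "0 < (\<Sum>b\<in>I. exp (\<beta> * a b))"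
    by (rule less_le_trans[rotated]) simp
  have "(\<Sum>b\<in>I. exp (\<beta> * a b)) \<le> (\<Sum>b'\<in>I. exp (\<beta> * a b))"
    using le assms(3) by (intro sum_mono) auto
  then have "ln (\<Sum>b\<in>I. exp (\<beta> * a b)) \<le> ln (card I * exp (\<beta> * a b))"
    using pos by simp
  also have "\<dots> = ln (card I) + \<beta> * a b"
    using assms by (subst ln_mult) (auto simp: card_gt_0_iff)
  finally have up: "ln (\<Sum>b\<in>I. exp (\<beta> * a b)) \<le> ln (card I) + \<beta> * a b" .
  have "\<beta> * a b \<le> ln (\<Sum>b\<in>I. exp (\<beta> * a b))"
    using lower pos by (simp add: ln_ge_iff)
  with up have "\<bar>ln (\<Sum>b\<in>I. exp (\<beta> * a b)) - \<beta> * a b\<bar> \<le> ln (card I)"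
    by linarith
  moreover have "ln (\<Sum>b\<in>I. exp (\<beta> * a b)) / \<beta> - a b = (ln (\<Sum>b\<in>I. exp (\<beta> * a b)) - \<beta> * a b) / \<beta>"
    using assms(3) by (simp add: field_simps)
  ultimately show ?thesis
    unfolding b(2) using assms(3) by (simp add: divide_right_mono)
qed

text \<open>
  The letter \<open>lab b i\<close> is the coordinate that path \<open>b\<close> picks at step \<open>i\<close>. When only step \<open>s\<close> varies, the
  sum of exponentials over all paths collapses to a sum over the coordinates, with the exponentials of the
  other steps of the paths as weights; this is the form treated by the one-step estimate.
\<close>
lemma max_path_exchange:
  fixes P Q :: "('l \<Rightarrow> real) measure" and lab :: "'c \<Rightarrow> nat \<Rightarrow> 'l" and t c :: real
  assumes L: "finite L"
    and P: "prob_space P" "sets P = sets (\<Pi>\<^sub>M l\<in>L. borel)"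
    and Q: "prob_space Q" "sets Q = sets (\<Pi>\<^sub>M l\<in>L. borel)"
    and third: "\<And>l. l \<in> L \<Longrightarrow> integrable P (\<lambda>x. \<bar>x l\<bar> ^ 3)" "\<And>l. l \<in> L \<Longrightarrow> integrable Q (\<lambda>x. \<bar>x l\<bar> ^ 3)"
    and mean: "\<And>l. l \<in> L \<Longrightarrow> (LINT x|P. x l) = (LINT x|Q. x l)"
    and second: "\<And>l l'. l \<in> L \<Longrightarrow> l' \<in> L \<Longrightarrow> (LINT x|P. x l * x l') = (LINT x|Q. x l * x l')"
    and \<tau>: "(\<Sum>l\<in>L. LINT x|P. \<bar>x l\<bar> ^ 3) + (\<Sum>l\<in>L. LINT x|Q. \<bar>x l\<bar> ^ 3) \<le> \<tau>"
    and I: "finite I" "I \<noteq> {}" and lab: "\<And>b i. b \<in> I \<Longrightarrow> i \<in> {1..n} \<Longrightarrow> lab b i \<in> L"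
    and \<beta>: "0 < \<beta>"
  defines "H \<equiv> \<lambda>x. Max ((\<lambda>b. \<Sum>i=1..n. x i (lab b i)) ` I)"
  shows "\<bar>(LINT x|(\<Pi>\<^sub>M i\<in>{1..n}. P). sin (t * H x + c)) - (LINT x|(\<Pi>\<^sub>M i\<in>{1..n}. Q). sin (t * H x + c))\<bar>
    \<le> 2 * \<bar>t\<bar> * ln (card I) / \<beta> + real n * ((\<bar>t\<bar> * \<beta>\<^sup>2 + t\<^sup>2 * \<beta> + \<bar>t\<bar> ^ 3) * \<tau>)"
proof -
  define h where "h x = sin (t / \<beta> * ln (\<Sum>b\<in>I. exp (\<beta> * (\<Sum>i=1..n. x i (lab b i)))) + c)"
    for x :: "nat \<Rightarrow> 'l \<Rightarrow> real"
  have soft: "\<bar>sin (t * H x + c) - h x\<bar> \<le> \<bar>t\<bar> * ln (card I) / \<beta>" for x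
  proof -
    have "\<bar>sin (t * H x + c) - h x\<bar> \<le> \<bar>(t * H x + c) - (t / \<beta> * ln (\<Sum>b\<in>I. exp (\<beta> * (\<Sum>i=1..n. x i (lab b i)))) + c)\<bar>"
      unfolding h_def by (rule abs_sin_diff_le)
    also have "\<dots> = \<bar>t\<bar> * \<bar>ln (\<Sum>b\<in>I. exp (\<beta> * (\<Sum>i=1..n. x i (lab b i)))) / \<beta> - H x\<bar>"
      by (subst abs_minus_commute) (simp add: right_diff_distrib flip: abs_mult)
    also have "\<dots> \<le> \<bar>t\<bar> * (ln (card I) / \<beta>)"
      unfolding H_def by (intro mult_left_mono log_sum_exp_approx_Max I \<beta>) auto
    finally show ?thesis by simp
  qed
  have smooth: "\<bar>(LINT x|(\<Pi>\<^sub>M i\<in>{1..n}. R). sin (t * H x + c)) - (LINT x|(\<Pi>\<^sub>M i\<in>{1..n}. R). h x)\<bar>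
      \<le> \<bar>t\<bar> * ln (card I) / \<beta>" and h_meas: "h \<in> borel_measurable (\<Pi>\<^sub>M i\<in>{1..n}. R)"
    if R: "prob_space R" "sets R = sets (\<Pi>\<^sub>M l\<in>L. borel)" for R
  proof -
    let ?R = "\<Pi>\<^sub>M i\<in>{1..n}. R"
    interpret prob_space ?R using R(1) by (intro prob_space_PiM)
    have coord: "(\<lambda>x. x i l) \<in> borel_measurable ?R" if "i \<in> {1..n}" "l \<in> L" for i l
    proof -
      have "(\<lambda>y. y l) \<in> borel_measurable R"
        using that by (simp add: measurable_cong_sets[OF R(2) refl])
      moreover have "(\<lambda>x. x i) \<in> measurable ?R R"
        using that by (intro measurable_component_singleton)
      ultimately show ?thesis by (rule measurable_compose[rotated])
    qed
    then have path: "(\<lambda>x. \<Sum>i=1..n. x i (lab b i)) \<in> borel_measurable ?R" if "b \<in> I" for b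
      using that lab by (intro borel_measurable_sum) auto
    show h: "h \<in> borel_measurable ?R"
      unfolding h_def[abs_def] using path by measurable
    have "H \<in> borel_measurable ?R"
      unfolding H_def using path I by (intro borel_measurable_Max)
    then have "(\<lambda>x. sin (t * H x + c)) \<in> borel_measurable ?R"
      by measurable
    then have int: "integrable ?R (\<lambda>x. sin (t * H x + c))"
      by (intro integrable_const_bound[where B=1]) simp_all
    moreover have "integrable ?R h"
      using h by (intro integrable_const_bound[where B=1]) (simp_all add: h_def)
    ultimately have "(LINT x|?R. sin (t * H x + c)) - (LINT x|?R. h x) = (LINT x|?R. sin (t * H x + c) - h x)"
      by simp
    also have "\<bar>\<dots>\<bar> \<le> (LINT x|?R. \<bar>t\<bar> * ln (card I) / \<beta>)"
      using int \<open>integrable ?R h\<close> soft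
      by (intro order.trans[OF integral_abs_bound] integral_mono) (auto simp del: One_nat_def)
    finally show "\<bar>(LINT x|?R. sin (t * H x + c)) - (LINT x|?R. h x)\<bar> \<le> \<bar>t\<bar> * ln (card I) / \<beta>"
      by (simp add: prob_space del: One_nat_def)
  qed
  have "\<bar>(LINT x|(\<Pi>\<^sub>M i\<in>{1..n}. P). h x) - (LINT x|(\<Pi>\<^sub>M i\<in>{1..n}. Q). h x)\<bar>
      \<le> real n * ((\<bar>t\<bar> * \<beta>\<^sup>2 + t\<^sup>2 * \<beta> + \<bar>t\<bar> ^ 3) * \<tau>)"
  proof (rule lindeberg_exchange[where C=1])
    show "\<bar>h x\<bar> \<le> 1" for x by (simp add: h_def)
    fix s and x :: "nat \<Rightarrow> 'l \<Rightarrow> real" assume s: "s \<in> {1..n}"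
    define w where "w b = exp (\<beta> * (\<Sum>i\<in>{1..n} - {s}. x i (lab b i)))" for b
    define A where "A l = (\<Sum>b\<in>{b \<in> I. lab b s = l}. w b)" for l
    have w: "0 < w b" for b by (simp add: w_def)
    have A_sum: "(\<Sum>l\<in>L. A l * g l) = (\<Sum>b\<in>I. w b * g (lab b s))" for g
    proof -
      have "(\<Sum>l\<in>L. A l * g l) = (\<Sum>l\<in>L. \<Sum>b\<in>{b \<in> I. lab b s = l}. w b * g (lab b s))"
        by (auto simp: A_def sum_distrib_right intro!: sum.cong)
      also have "\<dots> = (\<Sum>b\<in>I. w b * g (lab b s))"
        using L I lab s by (intro sum.group) auto
      finally show ?thesis .
    qed
    have "h (x(s := y)) = sin (t / \<beta> * ln (\<Sum>l\<in>L. A l * exp (\<beta> * y l)) + c)" for y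
    proof -
      have "exp (\<beta> * (\<Sum>i=1..n. (x(s := y)) i (lab b i))) = w b * exp (\<beta> * y (lab b s))" for b
      proof -
        have "(\<Sum>i=1..n. (x(s := y)) i (lab b i)) = y (lab b s) + (\<Sum>i\<in>{1..n} - {s}. x i (lab b i))"
          using s by (subst sum.remove[of _ s]) (auto intro!: sum.cong)
        then show ?thesis by (simp add: w_def algebra_simps exp_add)
      qed
      then show ?thesis by (simp add: h_def A_sum)
    qed
    moreover have "0 < (\<Sum>l\<in>L. A l)"
      using A_sum[of "\<lambda>_. 1"] w I by (simp add: sum_pos)
    moreover have "0 \<le> A l" for l
      unfolding A_def by (intro sum_nonneg less_imp_le[OF w])
    ultimately show "\<bar>(LINT y|P. h (x(s := y))) - (LINT y|Q. h (x(s := y)))\<bar>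
        \<le> (\<bar>t\<bar> * \<beta>\<^sup>2 + t\<^sup>2 * \<beta> + \<bar>t\<bar> ^ 3) * \<tau>"
      by (simp only:, intro sin_log_sum_exp_swap L P Q third mean second \<tau> \<beta>)
  qed (use P Q h_meas[OF P] in auto)
  then show ?thesis
    using smooth[OF P] smooth[OF Q] by linarith
qed

lemma (in prob_space) integral_iid_PiM:
  fixes f :: "(nat \<Rightarrow> 'v) \<Rightarrow> real"
  assumes n: "1 \<le> n" and indep: "indep_vars (\<lambda>_. S) V {1..n}"
    and ident: "\<And>i. i \<in> {1..n} \<Longrightarrow> distr M S (V i) = distr M S (V 1)"
    and f: "f \<in> borel_measurable (\<Pi>\<^sub>M i\<in>{1..n}. S)"
  shows "(LINT x|(\<Pi>\<^sub>M i\<in>{1..n}. distr M S (V 1)). f x) = (LINT \<omega>|M. f (\<lambda>i\<in>{1..n}. V i \<omega>))"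
proof -
  have V: "random_variable S (V i)" if "i \<in> {1..n}" for i
    using indep that by (simp add: indep_vars_def2)
  have "(\<Pi>\<^sub>M i\<in>{1..n}. distr M S (V 1)) = (\<Pi>\<^sub>M i\<in>{1..n}. distr M S (V i))"
    by (intro PiM_cong refl) (rule ident[symmetric])
  also have "\<dots> = distr M (\<Pi>\<^sub>M i\<in>{1..n}. S) (\<lambda>\<omega>. \<lambda>i\<in>{1..n}. V i \<omega>)"
  proof (rule indep_vars_iff_distr_eq_PiM'[THEN iffD1, symmetric])
    show "{1..n} \<noteq> {}" using n by simp
  qed (fact V indep)+
  finally have law: "(\<Pi>\<^sub>M i\<in>{1..n}. distr M S (V 1)) = distr M (\<Pi>\<^sub>M i\<in>{1..n}. S) (\<lambda>\<omega>. \<lambda>i\<in>{1..n}. V i \<omega>)" .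
  have "(\<lambda>\<omega>. \<lambda>i\<in>{1..n}. V i \<omega>) \<in> measurable M (\<Pi>\<^sub>M i\<in>{1..n}. S)"
    using V by (rule measurable_restrict)
  then show ?thesis
    unfolding law using f by (rule integral_distr)
qed

text \<open>
  The exchange estimate, transferred from product laws to iid vectors on two unrelated probability
  spaces: both expectations depend on the joint law of the steps only, which is a product.
\<close>
lemma max_path_comparison:
  fixes V :: "nat \<Rightarrow> 'a \<Rightarrow> 'l \<Rightarrow> real" and W :: "nat \<Rightarrow> 'w \<Rightarrow> 'l \<Rightarrow> real" and t c :: real
  assumes M: "prob_space M" and N: "prob_space N" and L: "finite L" and n: "1 \<le> n"
    and V: "prob_space.indep_vars M (\<lambda>_. \<Pi>\<^sub>M l\<in>L. borel) V {1..n}"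
      "\<And>i. i \<in> {1..n} \<Longrightarrow> distr M (\<Pi>\<^sub>M l\<in>L. borel) (V i) = distr M (\<Pi>\<^sub>M l\<in>L. borel) (V 1)"
    and W: "prob_space.indep_vars N (\<lambda>_. \<Pi>\<^sub>M l\<in>L. borel) W {1..n}"
      "\<And>i. i \<in> {1..n} \<Longrightarrow> distr N (\<Pi>\<^sub>M l\<in>L. borel) (W i) = distr N (\<Pi>\<^sub>M l\<in>L. borel) (W 1)"
    and third: "\<And>l. l \<in> L \<Longrightarrow> integrable M (\<lambda>\<omega>. \<bar>V 1 \<omega> l\<bar> ^ 3)"
      "\<And>l. l \<in> L \<Longrightarrow> integrable N (\<lambda>\<omega>. \<bar>W 1 \<omega> l\<bar> ^ 3)"
    and mean: "\<And>l. l \<in> L \<Longrightarrow> (LINT \<omega>|M. V 1 \<omega> l) = (LINT \<omega>|N. W 1 \<omega> l)"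
    and second: "\<And>l l'. l \<in> L \<Longrightarrow> l' \<in> L \<Longrightarrow>
      (LINT \<omega>|M. V 1 \<omega> l * V 1 \<omega> l') = (LINT \<omega>|N. W 1 \<omega> l * W 1 \<omega> l')"
    and \<tau>: "(\<Sum>l\<in>L. LINT \<omega>|M. \<bar>V 1 \<omega> l\<bar> ^ 3) + (\<Sum>l\<in>L. LINT \<omega>|N. \<bar>W 1 \<omega> l\<bar> ^ 3) \<le> \<tau>"
    and I: "finite I" "I \<noteq> {}" and lab: "\<And>b i. b \<in> I \<Longrightarrow> i \<in> {1..n} \<Longrightarrow> lab b i \<in> L"
    and \<beta>: "0 < \<beta>"
  shows "\<bar>(LINT \<omega>|M. sin (t * Max ((\<lambda>b. \<Sum>i=1..n. V i \<omega> (lab b i)) ` I) + c)) -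
      (LINT \<omega>|N. sin (t * Max ((\<lambda>b. \<Sum>i=1..n. W i \<omega> (lab b i)) ` I) + c))\<bar>
    \<le> 2 * \<bar>t\<bar> * ln (card I) / \<beta> + real n * ((\<bar>t\<bar> * \<beta>\<^sup>2 + t\<^sup>2 * \<beta> + \<bar>t\<bar> ^ 3) * \<tau>)"
proof -
  let ?S = "\<Pi>\<^sub>M l\<in>L. (borel :: real measure)"
  let ?P = "distr M ?S (V 1)" and ?Q = "distr N ?S (W 1)"
  interpret M: prob_space M by fact
  interpret N: prob_space N by fact
  have rv: "V 1 \<in> measurable M ?S" "W 1 \<in> measurable N ?S"
    using V(1) W(1) n unfolding M.indep_vars_def2 N.indep_vars_def2 by auto
  have f: "(\<lambda>x. sin (t * Max ((\<lambda>b. \<Sum>i=1..n. x i (lab b i)) ` I) + c)) \<in> borel_measurable (\<Pi>\<^sub>M i\<in>{1..n}. ?S)"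
  proof -
    have "(\<lambda>x. \<Sum>i=1..n. x i (lab b i)) \<in> borel_measurable (\<Pi>\<^sub>M i\<in>{1..n}. ?S)" if "b \<in> I" for b
    proof (intro borel_measurable_sum)
      fix i assume i: "i \<in> {1..n}"
      have "(\<lambda>x. x i) \<in> measurable (\<Pi>\<^sub>M i\<in>{1..n}. ?S) ?S" "(\<lambda>y. y (lab b i)) \<in> borel_measurable ?S"
        using i lab[OF that i] by (auto intro!: measurable_component_singleton)
      then show "(\<lambda>x. x i (lab b i)) \<in> borel_measurable (\<Pi>\<^sub>M i\<in>{1..n}. ?S)"
        by (rule measurable_compose)
    qed
    then have "(\<lambda>x. Max ((\<lambda>b. \<Sum>i=1..n. x i (lab b i)) ` I)) \<in> borel_measurable (\<Pi>\<^sub>M i\<in>{1..n}. ?S)"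
      using I by (intro borel_measurable_Max)
    then show ?thesis by measurable
  qed
  have restr: "(\<lambda>b. \<Sum>i=1..n. (\<lambda>i\<in>{1..n}. x i) i (lab b i)) = (\<lambda>b. \<Sum>i=1..n. x i (lab b i))" for x :: "nat \<Rightarrow> 'l \<Rightarrow> real"
    by (intro ext sum.cong) auto
  have EV: "(LINT x|(\<Pi>\<^sub>M i\<in>{1..n}. ?P). sin (t * Max ((\<lambda>b. \<Sum>i=1..n. x i (lab b i)) ` I) + c)) =
      (LINT \<omega>|M. sin (t * Max ((\<lambda>b. \<Sum>i=1..n. V i \<omega> (lab b i)) ` I) + c))"
    by (rule M.integral_iid_PiM[OF n V(1) _ f, unfolded restr]) (fact V(2))
  have EW: "(LINT x|(\<Pi>\<^sub>M i\<in>{1..n}. ?Q). sin (t * Max ((\<lambda>b. \<Sum>i=1..n. x i (lab b i)) ` I) + c)) =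
      (LINT \<omega>|N. sin (t * Max ((\<lambda>b. \<Sum>i=1..n. W i \<omega> (lab b i)) ` I) + c))"
    by (rule N.integral_iid_PiM[OF n W(1) _ f, unfolded restr]) (fact W(2))
  have meas: "(\<lambda>x. x l) \<in> borel_measurable ?S" if "l \<in> L" for l
    using that by simp
  note tr = integral_distr[OF rv(1)] integral_distr[OF rv(2)]
    integrable_distr_eq[OF rv(1)] integrable_distr_eq[OF rv(2)]
  have "\<bar>(LINT x|(\<Pi>\<^sub>M i\<in>{1..n}. ?P). sin (t * Max ((\<lambda>b. \<Sum>i=1..n. x i (lab b i)) ` I) + c)) -
     (LINT x|(\<Pi>\<^sub>M i\<in>{1..n}. ?Q). sin (t * Max ((\<lambda>b. \<Sum>i=1..n. x i (lab b i)) ` I) + c))\<bar>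
    \<le> 2 * \<bar>t\<bar> * ln (card I) / \<beta> + real n * ((\<bar>t\<bar> * \<beta>\<^sup>2 + t\<^sup>2 * \<beta> + \<bar>t\<bar> ^ 3) * \<tau>)"
  proof (rule max_path_exchange[OF L])
    show "prob_space ?P" "prob_space ?Q"
      using rv by (auto intro: M.prob_space_distr N.prob_space_distr)
    show "(\<Sum>l\<in>L. LINT x|?P. \<bar>x l\<bar> ^ 3) + (\<Sum>l\<in>L. LINT x|?Q. \<bar>x l\<bar> ^ 3) \<le> \<tau>"
    proof -
      have "(\<Sum>l\<in>L. LINT x|?P. \<bar>x l\<bar> ^ 3) = (\<Sum>l\<in>L. LINT \<omega>|M. \<bar>V 1 \<omega> l\<bar> ^ 3)"
        by (intro sum.cong refl integral_distr rv) (simp add: meas)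
      moreover have "(\<Sum>l\<in>L. LINT x|?Q. \<bar>x l\<bar> ^ 3) = (\<Sum>l\<in>L. LINT \<omega>|N. \<bar>W 1 \<omega> l\<bar> ^ 3)"
        by (intro sum.cong refl integral_distr rv) (simp add: meas)
      ultimately show ?thesis using \<tau> by simp
    qed
    show "integrable ?P (\<lambda>x. \<bar>x l\<bar> ^ 3)" "integrable ?Q (\<lambda>x. \<bar>x l\<bar> ^ 3)" if "l \<in> L" for l
      using third[OF that] that by (simp_all add: tr meas del: One_nat_def)
    show "(LINT x|?P. x l) = (LINT x|?Q. x l)" if "l \<in> L" for l
      using mean[OF that] that by (simp add: tr meas del: One_nat_def)
    show "(LINT x|?P. x l * x l') = (LINT x|?Q. x l * x l')" if "l \<in> L" "l' \<in> L" for l l'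
      using second[OF that] that by (simp add: tr meas del: One_nat_def)
    show "sets ?P = sets ?S" "sets ?Q = sets ?S" by simp_all
  qed (fact I lab \<beta>)+
  then show ?thesis
    unfolding EV EW .
qed

section \<open>Increasing subsequences and partitions of the index range\<close>

text \<open>
  The partitions are extensional functions so that there are finitely many of them.
\<close>
definition grid_partitions :: "nat \<Rightarrow> nat \<Rightarrow> (nat \<Rightarrow> nat) set" where
  "grid_partitions k n = {b \<in> {0..k} \<rightarrow>\<^sub>E {0..n}. b 0 = 0 \<and> b k = n \<and> mono_on {0..k} b}"

text \<open>
  Segment \<open>l\<close> of \<open>b\<close> consists of the indices in \<open>{b (l - 1)<..b l}\<close>; empty segments contain no index.
\<close>
definition segment :: "(nat \<Rightarrow> nat) \<Rightarrow> nat \<Rightarrow> nat" where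
  "segment b i = (LEAST l. i \<le> b l)"

lemma finite_grid_partitions: "finite (grid_partitions k n)"
  unfolding grid_partitions_def
  by (rule finite_subset[of _ "{0..k} \<rightarrow>\<^sub>E {0..n}"]) (auto intro: finite_PiE)

text \<open>
  The number of paths is polynomial in \<open>n\<close>: the cost of smoothing the maximum is its logarithm.
\<close>
lemma card_grid_partitions_le: "card (grid_partitions k n) \<le> (n + 1) ^ (k + 1)"
proof -
  have "card (grid_partitions k n) \<le> card ({0..k} \<rightarrow>\<^sub>E {0..n})"
    by (rule card_mono) (auto simp: grid_partitions_def intro: finite_PiE)
  then show ?thesis by (simp add: card_PiE)
qed

lemma grid_partitions_nonempty: "1 \<le> k \<Longrightarrow> grid_partitions k n \<noteq> {}"
proof -
  assume "1 \<le> k"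
  then have "(\<lambda>l\<in>{0..k}. if l = 0 then 0 else n) \<in> grid_partitions k n"
    by (auto simp: grid_partitions_def mono_on_def)
  then show ?thesis by blast
qed

lemma segment_eq_iff:
  assumes b: "b \<in> grid_partitions k n" and l: "l \<in> {1..k}" and i_n: "i \<in> {1..n}"
  shows "segment b i = l \<longleftrightarrow> b (l - 1) < i \<and> i \<le> b l"
proof -
  have mono: "\<And>l l'. l \<le> l' \<Longrightarrow> l' \<le> k \<Longrightarrow> b l \<le> b l'"
    using b by (auto simp: grid_partitions_def mono_on_def)
  have "b k = n" using b by (simp add: grid_partitions_def)
  then have ik: "i \<le> b k" using i_n by simp
  show ?thesis
  proof
    assume s: "segment b i = l"
    have "i \<le> b (segment b i)" unfolding segment_def using ik by (rule LeastI)
    moreover have "\<not> i \<le> b (l - 1)"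
      using not_less_Least[of "l - 1" "\<lambda>l. i \<le> b l"] s l unfolding segment_def by auto
    ultimately show "b (l - 1) < i \<and> i \<le> b l" using s by simp
  next
    assume i: "b (l - 1) < i \<and> i \<le> b l"
    show "segment b i = l"
      unfolding segment_def
    proof (rule Least_equality)
      fix l' assume l': "i \<le> b l'"
      show "l \<le> l'"
      proof (rule ccontr)
        assume "\<not> l \<le> l'"
        then have "b l' \<le> b (l - 1)" using l by (intro mono) auto
        then show False using i l' by simp
      qed
    qed (use i in simp)
  qed
qed

lemma segment_in:
  assumes b: "b \<in> grid_partitions k n" and i: "i \<in> {1..n}"
  shows "segment b i \<in> {1..k}"
proof -
  have "i \<le> b k" "b 0 < i" using b i by (auto simp: grid_partitions_def)
  then have "segment b i \<le> k" "i \<le> b (segment b i)"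
    unfolding segment_def by (auto intro: Least_le LeastI)
  with \<open>b 0 < i\<close> show ?thesis by (cases "segment b i") auto
qed

lemma segment_mono:
  assumes b: "b \<in> grid_partitions k n" and i: "i \<in> {1..n}" "i' \<in> {1..n}" "i \<le> i'"
  shows "segment b i \<le> segment b i'"
proof -
  have "i' \<le> b (segment b i')"
    using segment_eq_iff[OF b segment_in[OF b i(2)] i(2)] by simp
  then show ?thesis
    using i(3) unfolding segment_def[of b i] by (intro Least_le) simp
qed

lemma sum_by_segments:
  fixes f :: "nat \<Rightarrow> nat \<Rightarrow> real"
  assumes b: "b \<in> grid_partitions k n"
  shows "(\<Sum>i=1..n. f i (segment b i)) = (\<Sum>l=1..k. \<Sum>i\<in>{b (l - 1)<..b l}. f i l)"
proof -
  have "(\<Sum>i=1..n. f i (segment b i)) = (\<Sum>l=1..k. \<Sum>i\<in>{i \<in> {1..n}. segment b i = l}. f i (segment b i))"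
    using segment_in[OF b] by (intro sum.group[symmetric]) auto
  also have "\<dots> = (\<Sum>l=1..k. \<Sum>i\<in>{b (l - 1)<..b l}. f i l)"
  proof (intro sum.cong refl)
    fix l assume l: "l \<in> {1..k}"
    then have "b l \<in> {0..n}" using b by (auto simp: grid_partitions_def PiE_iff)
    then have "i \<in> {b (l - 1)<..b l} \<Longrightarrow> i \<in> {1..n}" for i by auto
    then show "{i \<in> {1..n}. segment b i = l} = {b (l - 1)<..b l}"
      using segment_eq_iff[OF b l] by (intro set_eqI) (auto simp del: One_nat_def)
    fix i assume "i \<in> {b (l - 1)<..b l}"
    with \<open>b l \<in> {0..n}\<close> show "f i (segment b i) = f i l"
      using segment_eq_iff[OF b l, of i] by (auto simp: Suc_le_eq)
  qed
  finally show ?thesis .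
qed

lemma
  shows LI_ge_card: "S \<subseteq> {1..n} \<Longrightarrow> mono_on S x \<Longrightarrow> card S \<le> LI x n"
    and LI_attained: "\<exists>S\<subseteq>{1..n}. mono_on S x \<and> card S = LI x n"
proof -
  define W where "W = {len. \<exists>i :: nat \<Rightarrow> nat. strict_mono_on {1..len} i \<and> i ` {1..len} \<subseteq> {1..n} \<and>
                        mono_on {1..len} (\<lambda>r. x (i r))}"
  have card_image: "card (i ` {1..len}) = len" if "strict_mono_on {1..len} i" for i :: "nat \<Rightarrow> nat" and len
    using card_image[OF strict_mono_on_imp_inj_on[OF that]] by simp
  have "len \<le> n" if "len \<in> W" for len
  proof -
    from that obtain i :: "nat \<Rightarrow> nat" where "strict_mono_on {1..len} i" "i ` {1..len} \<subseteq> {1..n}"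
      by (auto simp: W_def)
    then show ?thesis using card_mono[of "{1..n}" "i ` {1..len}"] card_image by simp
  qed
  then have fin: "finite W" by (intro finite_subset[of W "{..n}"]) auto
  have W: "card S \<in> W" if S: "S \<subseteq> {1..n}" and mono: "mono_on S x" for S
  proof -
    have "finite S" using S by (rule finite_subset) simp
    then obtain h where h: "bij_betw h {..<card S} S" "strict_mono_on {..<card S} h"
      using ex_bij_betw_strict_mono_card by blast
    define i where "i r = h (r - 1)" for r
    have hS: "h r \<in> S" if "r < card S" for r using h(1) that by (auto simp: bij_betw_def)
    have hm: "h r < h r'" if "r < r'" "r' < card S" for r r'
      using h(2) that by (auto simp: strict_mono_on_def)
    have iS: "i r \<in> S" if "r \<in> {1..card S}" for r
      using that hS[of "r - 1"] by (auto simp: i_def)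
    have im: "i r < i r'" if "r \<in> {1..card S}" "r' \<in> {1..card S}" "r < r'" for r r'
      using that hm[of "r - 1" "r' - 1"] by (auto simp: i_def)
    have "x (i r) \<le> x (i r')" if "r \<in> {1..card S}" "r' \<in> {1..card S}" "r \<le> r'" for r r'
      using that im[of r r'] iS[of r] iS[of r'] mono by (cases "r = r'") (auto simp: mono_on_def)
    then show ?thesis
      unfolding W_def using iS im S by (intro CollectI exI[of _ i]) (fastforce simp: strict_mono_on_def mono_on_def)
  qed
  have LI: "LI x n = Max W" by (simp add: LI_def W_def)
  show "card S \<le> LI x n" if "S \<subseteq> {1..n}" "mono_on S x"
    unfolding LI using fin W[OF that] by (rule Max_ge)
  have "card ({} :: nat set) \<in> W" by (intro W) (auto simp: mono_on_def)
  then have "LI x n \<in> W" unfolding LI using fin by (intro Max_in) auto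
  then obtain i :: "nat \<Rightarrow> nat" where i: "strict_mono_on {1..LI x n} i" "i ` {1..LI x n} \<subseteq> {1..n}"
      "mono_on {1..LI x n} (\<lambda>r. x (i r))"
    by (auto simp: W_def)
  have "mono_on (i ` {1..LI x n}) x"
  proof (rule monotone_onI)
    fix a a' assume "a \<in> i ` {1..LI x n}" "a' \<in> i ` {1..LI x n}" "a \<le> a'"
    then obtain r r' where r: "r \<in> {1..LI x n}" "r' \<in> {1..LI x n}" "a = i r" "a' = i r'" by blast
    have "r \<le> r'"
    proof (rule ccontr)
      assume "\<not> r \<le> r'"
      then have "i r' < i r" using i(1) r by (auto simp: strict_mono_on_def)
      then show False using r \<open>a \<le> a'\<close> by simp
    qed
    then show "x a \<le> x a'" using i(3) r by (auto simp: mono_on_def)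
  qed
  then show "\<exists>S\<subseteq>{1..n}. mono_on S x \<and> card S = LI x n"
    using i(1,2) card_image by blast
qed

lemma LI_ge_segment_matches:
  assumes b: "b \<in> grid_partitions k n" and c: "strict_mono_on {1..k} c"
  shows "card {i \<in> {1..n}. x i = c (segment b i)} \<le> LI x n"
proof (rule LI_ge_card)
  show "mono_on {i \<in> {1..n}. x i = c (segment b i)} x"
  proof (rule monotone_onI)
    fix i i' assume i: "i \<in> {i \<in> {1..n}. x i = c (segment b i)}" "i' \<in> {i \<in> {1..n}. x i = c (segment b i)}" "i \<le> i'"
    then have "segment b i \<le> segment b i'" "segment b i \<in> {1..k}" "segment b i' \<in> {1..k}"
      using segment_mono[OF b] segment_in[OF b] by auto
    then show "x i \<le> x i'"
      using i strict_mono_on_imp_mono_on[OF c] by (auto simp: mono_on_def)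
  qed
qed auto

text \<open>
  Given a longest increasing subsequence, with index set \<open>S\<close>, let segment \<open>l\<close> end at the last index of \<open>S\<close>
  carrying a letter at most \<open>c l\<close>. Then an occurrence of \<open>c l\<close> in \<open>S\<close> lies in segment \<open>l\<close>, and the
  occurrences of another letter \<open>a\<close> lie in a block \<open>{u a<..v a}\<close> within a single segment \<open>l a\<close>. The
  blocks of distinct letters are disjoint and contain no other index of \<open>S\<close>. Replacing \<open>a\<close> by \<open>c (l a)\<close>
  on each of these blocks loses at most the stated difference of counts.
\<close>
lemma LI_le_segment_matches:
  fixes x :: "nat \<Rightarrow> 'b::linorder"
  assumes k: "1 \<le> k" and c: "strict_mono_on {1..k} c" and U: "finite U" "U \<inter> c ` {1..k} = {}"
    and x: "\<And>i. i \<in> {1..n} \<Longrightarrow> x i \<in> c ` {1..k} \<union> U"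
  shows "\<exists>b\<in>grid_partitions k n. \<exists>l\<in>U \<rightarrow> {1..k}. \<exists>u\<in>U \<rightarrow> {0..n}. \<exists>v\<in>U \<rightarrow> {0..n}.
    real (LI x n) \<le> real (card {i \<in> {1..n}. x i = c (segment b i)}) +
      (\<Sum>a\<in>U. real (card {i \<in> {u a<..v a}. x i = a}) - real (card {i \<in> {u a<..v a}. x i = c (l a)}))"
proof -
  obtain S where S: "S \<subseteq> {1..n}" "mono_on S x" "card S = LI x n"
    using LI_attained[of n x] by blast
  have finS: "finite S" using S(1) by (rule finite_subset) simp
  have cm: "c l < c l'" if "l \<in> {1..k}" "l' \<in> {1..k}" "l < l'" for l l'
    using c that by (auto simp: strict_mono_on_def)
  have Sm: "x i \<le> x i'" if "i \<in> S" "i' \<in> S" "i \<le> i'" for i i'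
    using S(2) that by (auto simp: mono_on_def)
  define b where "b = (\<lambda>l\<in>{0..k}. if l = 0 then 0 else if l = k then n else Max (insert 0 {i \<in> S. x i \<le> c l}))"
  have b0k: "b 0 = 0" "b k = n" using k by (auto simp: b_def)
  have bl: "b l = Max (insert 0 {i \<in> S. x i \<le> c l})" if "1 \<le> l" "l < k" for l
    using that by (simp add: b_def)
  have b_n: "b l \<le> n" if "l \<le> k" for l
  proof (cases "1 \<le> l \<and> l < k")
    case True
    then show ?thesis using S(1) finS by (subst bl) auto
  next
    case False
    then show ?thesis using b0k that by (cases "l = 0") auto
  qed
  have b_mono: "b l \<le> b l'" if "l \<le> l'" "l' \<le> k" for l l'
  proof (cases "1 \<le> l \<and> l' < k")
    case True
    then have "c l \<le> c l'" using cm[of l l'] that by (cases "l = l'") auto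
    then show ?thesis
      using True that finS by (subst bl, simp, simp, subst bl, simp, simp) (intro Max_mono, auto)
  next
    case False
    then show ?thesis using b0k b_n[of l] that by (cases "l = 0") auto
  qed
  have b: "b \<in> grid_partitions k n"
    using b0k b_n b_mono by (auto simp: grid_partitions_def mono_on_def b_def)
  \<comment> \<open>On \<open>S\<close> the segment of an index is determined by its letter.\<close>
  have below: "i \<le> b l \<longleftrightarrow> x i \<le> c l" if "i \<in> S" "1 \<le> l" "l < k" for i l
  proof
    have i0: "0 < i" using that S(1) by auto
    assume i: "i \<le> b l"
    have "b l \<in> insert 0 {i \<in> S. x i \<le> c l}"
      unfolding bl[OF that(2,3)] using finS by (intro Max_in) auto
    then have "b l \<in> S" "x (b l) \<le> c l" using i i0 by auto
    then show "x i \<le> c l" using Sm[of i "b l"] i that by auto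
  next
    assume "x i \<le> c l"
    then show "i \<le> b l"
      unfolding bl[OF that(2,3)] using that finS by (intro Max_ge) auto
  qed
  have match: "segment b i = l" if i: "i \<in> S" "x i = c l" and l: "l \<in> {1..k}" for i l
  proof -
    have i_n: "i \<in> {1..n}" using i S(1) by auto
    have "i \<le> b l"
      using i l i_n below[of i l] b0k(2) by (cases "l = k") auto
    moreover have "b (l - 1) < i"
    proof (cases "l = 1")
      case True then show ?thesis using b0k i_n by simp
    next
      case False
      then have "c (l - 1) < c l" using l by (intro cm) auto
      moreover have "1 \<le> l - 1" "l - 1 < k" using l False by auto
      ultimately show ?thesis using below[of i "l - 1"] i by (simp flip: not_le del: One_nat_def)
    qed
    ultimately show ?thesis using segment_eq_iff[OF b l i_n] by simp
  qed
  have same: "segment b i = segment b i'" if "i \<in> S" "i' \<in> S" "x i = x i'" for i i'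
  proof -
    have in_n: "i \<in> {1..n}" "i' \<in> {1..n}" using that S(1) by auto
    note l = segment_in[OF b in_n(1)]
    have *: "i \<le> b l' \<longleftrightarrow> i' \<le> b l'" if "l' \<le> k" for l'
    proof (cases "1 \<le> l' \<and> l' < k")
      case True
      then show ?thesis using below[OF \<open>i \<in> S\<close>, of l'] below[OF \<open>i' \<in> S\<close>, of l'] \<open>x i = x i'\<close> by simp
    next
      case False
      then show ?thesis using b0k in_n that by (cases "l' = 0") auto
    qed
    have "b (segment b i - 1) < i \<and> i \<le> b (segment b i)"
      using segment_eq_iff[OF b l in_n(1)] by simp
    then have "b (segment b i - 1) < i' \<and> i' \<le> b (segment b i)"
      using *[of "segment b i"] *[of "segment b i - 1"] l
      by (simp flip: not_le del: One_nat_def add: le_diff_conv)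
    then show ?thesis using segment_eq_iff[OF b l in_n(2)] by simp
  qed
  define Sa where "Sa a = {i \<in> S. x i = a}" for a
  have finSa: "finite (Sa a)" for a using finS by (simp add: Sa_def)
  define u where "u a = (if Sa a = {} then 0 else Min (Sa a) - 1)" for a
  define v where "v a = (if Sa a = {} then 0 else Max (Sa a))" for a
  define l where "l a = (if Sa a = {} then 1 else segment b (Max (Sa a)))" for a
  have Sa_n: "Sa a \<subseteq> {1..n}" for a using S(1) by (auto simp: Sa_def)
  have MM: "Min (Sa a) \<in> Sa a" "Max (Sa a) \<in> Sa a" if "Sa a \<noteq> {}" for a
    using that finSa by auto
  have interval: "{u a<..v a} = {Min (Sa a)..Max (Sa a)}" if "Sa a \<noteq> {}" for a
  proof -
    have "1 \<le> Min (Sa a)" using MM(1)[OF that] Sa_n by fastforce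
    then show ?thesis using that by (auto simp: u_def v_def)
  qed
  have MM_n: "Min (Sa a) \<in> {1..n}" "Max (Sa a) \<in> {1..n}" if "Sa a \<noteq> {}" for a
    using MM[OF that] Sa_n by blast+
  have v: "v a \<in> {0..n}" for a using MM_n(2)[of a] by (cases "Sa a = {}") (simp_all add: v_def)
  have u: "u a \<in> {0..n}" for a using MM_n(1)[of a] by (cases "Sa a = {}") (simp_all add: u_def le_diff_conv)
  have l: "l a \<in> {1..k}" for a
    using segment_in[OF b MM_n(2)[of a]] k by (auto simp: l_def)
  have inside: "x i = a" if "i \<in> S" "i \<in> {u a<..v a}" for i a
  proof -
    have ne: "Sa a \<noteq> {}" using that by (auto simp: u_def v_def)
    have "x (Min (Sa a)) = a" "x (Max (Sa a)) = a" "Min (Sa a) \<in> S" "Max (Sa a) \<in> S"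
      using MM[OF ne] by (auto simp: Sa_def)
    then show ?thesis
      using that(2) Sm[of "Min (Sa a)" i] Sm[of i "Max (Sa a)"] that(1) by (auto simp: interval[OF ne])
  qed
  define G where "G = {i \<in> {1..n}. x i = c (segment b i)}"
  define W where "W a = {i \<in> {u a<..v a}. x i = c (l a)}" for a
  define S' where "S' = {i \<in> S. x i \<notin> U}"
  \<comment> \<open>The matches \<open>W a\<close> inside the blocks and the matches \<open>S'\<close> that belong to \<open>S\<close> are disjoint subsets of
    all matches \<open>G\<close>, so they can be counted separately.\<close>
  have W_sub: "W a \<subseteq> G" for a
  proof
    fix i assume i: "i \<in> W a"
    then have ne: "Sa a \<noteq> {}" by (auto simp: W_def u_def v_def)
    note m = MM_n[OF ne]
    have i': "Min (Sa a) \<le> i" "i \<le> Max (Sa a)" using i interval[OF ne] by (auto simp: W_def)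
    then have i_n: "i \<in> {1..n}" using m by auto
    have "segment b (Min (Sa a)) = segment b (Max (Sa a))"
      using same MM[OF ne] by (auto simp: Sa_def)
    then have "segment b i = l a"
      using segment_mono[OF b m(1) i_n i'(1)] segment_mono[OF b i_n m(2) i'(2)] ne by (simp add: l_def)
    then show "i \<in> G" using i i_n by (simp add: G_def W_def)
  qed
  have S'_sub: "S' \<subseteq> G"
  proof
    fix i assume i: "i \<in> S'"
    then have i_n: "i \<in> {1..n}" using S(1) by (auto simp: S'_def)
    then obtain l where "l \<in> {1..k}" "x i = c l" using x[of i] i by (auto simp: S'_def)
    then show "i \<in> G" using match[of i l] i i_n by (auto simp: G_def S'_def)
  qed
  have disj1: "S' \<inter> W a = {}" if "a \<in> U" for a
    using inside that by (auto simp: S'_def W_def)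
  have disj2: "W a \<inter> W a' = {}" if "a \<noteq> a'" for a a'
  proof (rule ccontr)
    assume "W a \<inter> W a' \<noteq> {}"
    then obtain i where i: "i \<in> W a" "i \<in> W a'" by auto
    have ne: "Sa a \<noteq> {}" "Sa a' \<noteq> {}" using i by (auto simp: W_def u_def v_def)
    have *: "Min (Sa a) \<le> Max (Sa a')" "Min (Sa a') \<le> Max (Sa a)"
      using i interval[OF ne(1)] interval[OF ne(2)] by (auto simp: W_def)
    have ext: "Min (Sa a'') \<in> S" "x (Min (Sa a'')) = a''" "Max (Sa a'') \<in> S" "x (Max (Sa a'')) = a''"
      if "Sa a'' \<noteq> {}" for a''
      using MM[OF that] by (simp_all add: Sa_def)
    have "a \<le> a'" using Sm[OF ext(1)[OF ne(1)] ext(3)[OF ne(2)] *(1)] ext(2,4) ne by simp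
    moreover have "a' \<le> a" using Sm[OF ext(1)[OF ne(2)] ext(3)[OF ne(1)] *(2)] ext(2,4) ne by simp
    ultimately have "a = a'" by simp
    then show False using that by simp
  qed
  have fin: "finite (W a)" "finite G" "finite S'" for a
    by (auto simp: W_def G_def S'_def finS)
  have "card S' + (\<Sum>a\<in>U. card (W a)) = card (S' \<union> (\<Union>a\<in>U. W a))"
    using U(1) fin disj1 disj2 by (subst card_Un_disjoint) (auto simp: card_UN_disjoint)
  also have "\<dots> \<le> card G"
    using W_sub S'_sub fin by (intro card_mono) auto
  finally have G: "card S' + (\<Sum>a\<in>U. card (W a)) \<le> card G" .
  have "S = S' \<union> (\<Union>a\<in>U. Sa a)" by (auto simp: S'_def Sa_def)
  also have "card \<dots> = card S' + card (\<Union>a\<in>U. Sa a)"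
    using U(1) fin finSa by (intro card_Un_disjoint) (auto simp: S'_def Sa_def)
  also have "card (\<Union>a\<in>U. Sa a) = (\<Sum>a\<in>U. card (Sa a))"
    using U(1) finSa by (intro card_UN_disjoint) (auto simp: Sa_def)
  finally have "card S = card S' + (\<Sum>a\<in>U. card (Sa a))" .
  moreover have "card (Sa a) \<le> card {i \<in> {u a<..v a}. x i = a}" for a
  proof (cases "Sa a = {}")
    case False
    have "Sa a \<subseteq> {i \<in> {u a<..v a}. x i = a}"
      unfolding interval[OF False] using finSa by (auto simp: Sa_def)
    then show ?thesis by (intro card_mono) auto
  qed simp
  then have "(\<Sum>a\<in>U. card (Sa a)) \<le> (\<Sum>a\<in>U. card {i \<in> {u a<..v a}. x i = a})"
    by (rule sum_mono)
  ultimately have "LI x n + (\<Sum>a\<in>U. card (W a)) \<le> card G + (\<Sum>a\<in>U. card {i \<in> {u a<..v a}. x i = a})"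
    using G S(3) by linarith
  then have "real (LI x n + (\<Sum>a\<in>U. card (W a))) \<le> real (card G + (\<Sum>a\<in>U. card {i \<in> {u a<..v a}. x i = a}))"
    by (rule of_nat_mono)
  then have "real (LI x n) \<le> real (card G) +
      (\<Sum>a\<in>U. real (card {i \<in> {u a<..v a}. x i = a}) - real (card (W a)))"
    by (simp add: sum_subtractf)
  then show ?thesis
    using b u v l unfolding G_def W_def
    by (intro bexI[of _ b] bexI[of _ l] bexI[of _ u] bexI[of _ v]) auto
qed

lemma LI_cong:
  assumes "\<And>i. i \<in> {1..n} \<Longrightarrow> x i = y i"
  shows "LI x n = LI y n"
proof -
  have "LI x n \<le> LI y n" if "\<And>i. i \<in> {1..n} \<Longrightarrow> x i = y i" for x y :: "nat \<Rightarrow> 'a"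
  proof -
    obtain S where S: "S \<subseteq> {1..n}" "mono_on S x" "card S = LI x n"
      using LI_attained[of n x] by blast
    have "y i = x i" if "i \<in> S" for i
      using that S(1) \<open>\<And>i. i \<in> {1..n} \<Longrightarrow> x i = y i\<close>[of i] by auto
    then have "mono_on S y"
      using S(2) by (simp add: mono_on_def)
    then show ?thesis using LI_ge_card[OF S(1), of y] S(3) by simp
  qed
  then show ?thesis using assms by (intro antisym) simp_all
qed

section \<open>The random word\<close>

text \<open>
  The exponent \<open>ln (pc / pa)\<close> is chosen so that a single letter contributes
  \<open>pa * (pc / pa) + pc * (pa / pc) + (1 - pa - pc) = 1\<close>; independence does the rest.
\<close>
lemma (in prob_space) expectation_exp_letter_excess:
  assumes J: "finite J" and indep: "indep_vars (\<lambda>_. count_space A) X J"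
    and ac: "a \<noteq> c" and p: "0 < pa" "0 < pc"
    and Xa: "\<And>i. i \<in> J \<Longrightarrow> prob {\<omega> \<in> space M. X i \<omega> = a} = pa"
    and Xc: "\<And>i. i \<in> J \<Longrightarrow> prob {\<omega> \<in> space M. X i \<omega> = c} = pc"
  defines "D \<equiv> \<lambda>\<omega>. real (card {i \<in> J. X i \<omega> = a}) - real (card {i \<in> J. X i \<omega> = c})"
  shows "integrable M (\<lambda>\<omega>. exp (ln (pc / pa) * D \<omega>))"
    and "expectation (\<lambda>\<omega>. exp (ln (pc / pa) * D \<omega>)) = 1"
proof -
  define g where "g x = 1 + (pc / pa - 1) * of_bool (x = a) + (pa / pc - 1) * of_bool (x = c)" for x
  have D: "exp (ln (pc / pa) * D \<omega>) = (\<Prod>i\<in>J. g (X i \<omega>))" for \<omega>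
  proof -
    have "D \<omega> = (\<Sum>i\<in>J. of_bool (X i \<omega> = a) - of_bool (X i \<omega> = c))"
      using J by (simp add: D_def sum_subtractf Int_def)
    then have "exp (ln (pc / pa) * D \<omega>) = (\<Prod>i\<in>J. exp (ln (pc / pa) * (of_bool (X i \<omega> = a) - of_bool (X i \<omega> = c))))"
      using J by (simp add: sum_distrib_left exp_sum)
    also have "\<dots> = (\<Prod>i\<in>J. g (X i \<omega>))"
      using ac p by (intro prod.cong) (auto simp: g_def exp_minus)
    finally show ?thesis .
  qed
  have X: "random_variable (count_space A) (X i)" if "i \<in> J" for i
    using indep that by (simp add: indep_vars_def2)
  have ev: "{\<omega> \<in> space M. X i \<omega> = y} \<in> events" if "i \<in> J" for i y
  proof -
    have "X i -` ({y} \<inter> A) \<inter> space M \<in> events"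
      using X[OF that] by (rule measurable_sets) auto
    also have "X i -` ({y} \<inter> A) \<inter> space M = {\<omega> \<in> space M. X i \<omega> = y}"
      using measurable_space[OF X[OF that]] by auto
    finally show ?thesis .
  qed
  have ind: "indep_vars (\<lambda>_. borel) (\<lambda>i \<omega>. g (X i \<omega>)) J"
    using indep by (rule indep_vars_compose2) simp
  have g_ind: "g (X i \<omega>) = 1 + (pc / pa - 1) * indicator {\<omega> \<in> space M. X i \<omega> = a} \<omega>
      + (pa / pc - 1) * indicator {\<omega> \<in> space M. X i \<omega> = c} \<omega>" if "\<omega> \<in> space M" for i \<omega>
    using that by (auto simp: g_def indicator_def)
  have gi: "integrable M (\<lambda>\<omega>. g (X i \<omega>))" "expectation (\<lambda>\<omega>. g (X i \<omega>)) = 1" if "i \<in> J" for i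
  proof -
    show "integrable M (\<lambda>\<omega>. g (X i \<omega>))"
      using ev[OF that] by (subst Bochner_Integration.integrable_cong[OF refl g_ind])
        (auto simp: emeasure_eq_measure less_top[symmetric])
    have "expectation (\<lambda>\<omega>. g (X i \<omega>)) = expectation (\<lambda>\<omega>. 1 + (pc / pa - 1) * indicator {\<omega> \<in> space M. X i \<omega> = a} \<omega>
      + (pa / pc - 1) * indicator {\<omega> \<in> space M. X i \<omega> = c} \<omega>)"
      using g_ind by (intro Bochner_Integration.integral_cong) auto
    also have "\<dots> = 1 + (pc / pa - 1) * pa + (pa / pc - 1) * pc"
      using ev[OF that] Xa[OF that] Xc[OF that]
      by (simp add: prob_space emeasure_eq_measure less_top[symmetric] Int_absorb2 subset_iff)
    also have "\<dots> = 1" using p by (simp add: field_simps)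
    finally show "expectation (\<lambda>\<omega>. g (X i \<omega>)) = 1" .
  qed
  show "integrable M (\<lambda>\<omega>. exp (ln (pc / pa) * D \<omega>))"
    unfolding D using J ind gi(1) by (rule indep_vars_integrable)
  have "expectation (\<lambda>\<omega>. \<Prod>i\<in>J. g (X i \<omega>)) = (\<Prod>i\<in>J. expectation (\<lambda>\<omega>. g (X i \<omega>)))"
    using J ind gi(1) by (rule indep_vars_lebesgue_integral)
  also have "\<dots> = 1" using gi(2) by simp
  finally show "expectation (\<lambda>\<omega>. exp (ln (pc / pa) * D \<omega>)) = 1" unfolding D .
qed

text \<open>
  A function of finitely many letters from a finite alphabet is a finite sum over the possible words.
\<close>
lemma (in prob_space) borel_measurable_finite_letters:
  fixes f :: "(nat \<Rightarrow> 'b) \<Rightarrow> real"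
  assumes A: "finite A" and X: "\<And>i. i \<in> {1..n} \<Longrightarrow> random_variable (count_space A) (X i)"
    and f: "\<And>x y. (\<And>i. i \<in> {1..n} \<Longrightarrow> x i = y i) \<Longrightarrow> f x = f y"
  shows "(\<lambda>\<omega>. f (\<lambda>i. X i \<omega>)) \<in> borel_measurable M"
proof -
  let ?W = "{1..n} \<rightarrow>\<^sub>E A"
  have "f (\<lambda>i. X i \<omega>) = (\<Sum>w\<in>?W. f w * (\<Prod>i=1..n. indicator {w i} (X i \<omega>)))" if "\<omega> \<in> space M" for \<omega>
  proof -
    define w where "w = (\<lambda>i\<in>{1..n}. X i \<omega>)"
    have w: "w \<in> ?W" using measurable_space[OF X that] by (auto simp: w_def)
    have "(\<Sum>w\<in>?W. f w * (\<Prod>i=1..n. indicator {w i} (X i \<omega>))) = (\<Sum>w'\<in>?W. if w' = w then f w else 0)"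
    proof (intro sum.cong refl)
      fix w' assume w': "w' \<in> ?W"
      show "f w' * (\<Prod>i=1..n. indicator {w' i} (X i \<omega>)) = (if w' = w then f w else 0)"
      proof (cases "w' = w")
        case True
        then show ?thesis by (simp add: w_def)
      next
        case False
        then obtain i where "i \<in> {1..n}" "w' i \<noteq> w i" using w' w by (metis PiE_ext)
        then have "(\<Prod>i=1..n. indicator {w' i} (X i \<omega>) :: real) = 0"
          by (intro prod_zero) (auto simp: w_def intro!: bexI[of _ i])
        then show ?thesis using False by simp
      qed
    qed
    also have "\<dots> = f w" using w A by (simp add: finite_PiE)
    also have "\<dots> = f (\<lambda>i. X i \<omega>)" by (intro f) (simp add: w_def)
    finally show ?thesis by simp
  qed
  moreover have "(\<lambda>\<omega>. \<Sum>w\<in>?W. f w * (\<Prod>i=1..n. indicator {w i} (X i \<omega>))) \<in> borel_measurable M"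
  proof (intro borel_measurable_sum borel_measurable_times borel_measurable_prod borel_measurable_const)
    fix w i assume "i \<in> {1..n}"
    then show "(\<lambda>\<omega>. indicator {w i} (X i \<omega>) :: real) \<in> borel_measurable M"
      by (rule measurable_compose[OF X]) simp
  qed
  ultimately show ?thesis by (subst measurable_cong)
qed

text \<open>
  The part of the longest increasing subsequence that survives in the limit: only the \<open>k\<close> most probable
  letters are used.
\<close>
definition segment_matches :: "nat \<Rightarrow> (nat \<Rightarrow> 'b) \<Rightarrow> (nat \<Rightarrow> 'b) \<Rightarrow> nat \<Rightarrow> nat" where
  "segment_matches k c x n = Max ((\<lambda>b. card {i \<in> {1..n}. x i = c (segment b i)}) ` grid_partitions k n)"

lemma segment_matches_le_LI:
  assumes "1 \<le> k" "strict_mono_on {1..k} c"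
  shows "segment_matches k c x n \<le> LI x n"
  unfolding segment_matches_def
  using assms finite_grid_partitions grid_partitions_nonempty[of k n] LI_ge_segment_matches[of _ k n c x]
  by (subst Max_le_iff) auto

text \<open>
  Since \<open>y \<le> exp y\<close>, an excess \<open>D\<close> satisfies \<open>D \<le> (s + exp (- s) exp (r D)) / r\<close> for every \<open>s\<close> and
  \<open>r > 0\<close>. The block and the segment that realise the excess are random, so the exponentials are summed
  over all \<open>k (n + 1)\<^sup>2\<close> possibilities, each of expectation \<open>1\<close>. The choice \<open>s = 2 ln (n + 1)\<close> makes
  \<open>exp (- s)\<close> cancel the number of blocks.
\<close>
lemma (in prob_space) expectation_LI_minus_segment_matches:
  fixes X :: "nat \<Rightarrow> 'a \<Rightarrow> 'b::linorder" and c :: "nat \<Rightarrow> 'b"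
  assumes k: "1 \<le> k" and c: "strict_mono_on {1..k} c"
    and U: "finite U" "U \<inter> c ` {1..k} = {}"
    and indep: "indep_vars (\<lambda>_. count_space (c ` {1..k} \<union> U)) X {1..n}"
    and pmax: "0 < pmax" and max: "\<And>i l. i \<in> {1..n} \<Longrightarrow> l \<in> {1..k} \<Longrightarrow> prob {\<omega> \<in> space M. X i \<omega> = c l} = pmax"
    and less: "\<And>i a. i \<in> {1..n} \<Longrightarrow> a \<in> U \<Longrightarrow> prob {\<omega> \<in> space M. X i \<omega> = a} = q a"
    and q: "\<And>a. a \<in> U \<Longrightarrow> 0 < q a \<and> q a < pmax"
  shows "integrable M (\<lambda>\<omega>. real (LI (\<lambda>i. X i \<omega>) n) - real (segment_matches k c (\<lambda>i. X i \<omega>) n))" (is "integrable M ?d")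
    and "expectation (\<lambda>\<omega>. real (LI (\<lambda>i. X i \<omega>) n) - real (segment_matches k c (\<lambda>i. X i \<omega>) n))
      \<le> (2 * ln (real n + 1) + k) * (\<Sum>a\<in>U. 1 / ln (pmax / q a))"
proof -
  define A where "A = c ` {1..k} \<union> U"
  have A: "finite A" using U by (simp add: A_def)
  have X: "random_variable (count_space A) (X i)" if "i \<in> {1..n}" for i
    using indep that unfolding indep_vars_def2 A_def by blast
  have XA: "X i \<omega> \<in> A" if "i \<in> {1..n}" "\<omega> \<in> space M" for i \<omega>
    using measurable_space[OF X[OF that(1)] that(2)] by simp
  define r where "r a = ln (pmax / q a)" for a
  have r: "0 < r a" if "a \<in> U" for a using q[OF that] by (simp add: r_def)
  define D where "D a l u v \<omega> = real (card {i \<in> {u<..v}. X i \<omega> = a}) - real (card {i \<in> {u<..v}. X i \<omega> = c l})"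
    for a l u v \<omega>
  have D: "integrable M (\<lambda>\<omega>. exp (r a * D a l u v \<omega>))" "expectation (\<lambda>\<omega>. exp (r a * D a l u v \<omega>)) = 1"
    if "a \<in> U" "l \<in> {1..k}" "u \<in> {0..n}" "v \<in> {0..n}" for a l u v
  proof -
    have sub: "{u<..v} \<subseteq> {1..n}" using that by auto
    have ind: "indep_vars (\<lambda>_. count_space A) X {u<..v}"
      using indep_vars_subset[OF indep sub] by (simp add: A_def)
    have "a \<noteq> c l" using that U by auto
    moreover have "prob {\<omega> \<in> space M. X i \<omega> = a} = q a" "prob {\<omega> \<in> space M. X i \<omega> = c l} = pmax"
      if "i \<in> {u<..v}" for i
      using that sub less[of i a] max[of i l] \<open>a \<in> U\<close> \<open>l \<in> {1..k}\<close> by blast+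
    moreover have "0 < q a" using q \<open>a \<in> U\<close> by blast
    ultimately show "integrable M (\<lambda>\<omega>. exp (r a * D a l u v \<omega>))" "expectation (\<lambda>\<omega>. exp (r a * D a l u v \<omega>)) = 1"
      unfolding r_def D_def using pmax ind
      by (auto intro!: expectation_exp_letter_excess[where J="{u<..v}"] simp del: greaterThanAtMost_iff)
  qed
  define s where "s = 2 * ln (real n + 1)"
  define E where "E \<omega> = (\<Sum>a\<in>U. (s + (\<Sum>l\<in>{1..k}. \<Sum>u\<in>{0..n}. \<Sum>v\<in>{0..n}. exp (- s) * exp (r a * D a l u v \<omega>))) / r a)" for \<omega>
  have "has_bochner_integral M (\<lambda>_. s) s"
    by (simp add: has_bochner_integral_iff prob_space)
  moreover have "has_bochner_integral M (\<lambda>\<omega>. exp (- s) * exp (r a * D a l u v \<omega>)) (exp (- s))"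
    if "a \<in> U" "l \<in> {1..k}" "u \<in> {0..n}" "v \<in> {0..n}" for a l u v
    using D[OF that] by (simp add: has_bochner_integral_iff)
  ultimately have "has_bochner_integral M E
      (\<Sum>a\<in>U. (s + (\<Sum>l\<in>{1..k}. \<Sum>u\<in>{0..n}. \<Sum>v\<in>{0..n}. exp (- s))) / r a)"
    unfolding E_def[abs_def]
    by (intro has_bochner_integral_sum has_bochner_integral_divide_zero has_bochner_integral_add)
  then have E_int: "integrable M E" and
    "expectation E = (\<Sum>a\<in>U. (s + (\<Sum>l\<in>{1..k}. \<Sum>u\<in>{0..n}. \<Sum>v\<in>{0..n}. exp (- s))) / r a)"
    by (simp_all add: has_bochner_integral_iff)
  note this(2)
  also have "(\<Sum>l\<in>{1..k}. \<Sum>u\<in>{0..n}. \<Sum>v\<in>{0..n}. exp (- s)) = real k"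
  proof -
    have "exp s = (real n + 1)\<^sup>2"
      by (simp add: s_def exp_double)
    then have "(real n + 1)\<^sup>2 * exp (- s) = 1"
      by (metis exp_minus_inverse)
    moreover have "(\<Sum>l\<in>{1..k}. \<Sum>u\<in>{0..n}. \<Sum>v\<in>{0..n}. exp (- s)) = real k * ((real n + 1)\<^sup>2 * exp (- s))"
      by (simp add: power2_eq_square algebra_simps)
    ultimately show ?thesis by simp
  qed
  also have "(\<Sum>a\<in>U. (s + real k) / r a) = (s + k) * (\<Sum>a\<in>U. 1 / r a)"
    by (simp add: sum_distrib_left)
  finally have E_exp: "expectation E = (s + k) * (\<Sum>a\<in>U. 1 / r a)" .
  have nonneg: "0 \<le> ?d \<omega>" for \<omega>
    using segment_matches_le_LI[OF k c, of "\<lambda>i. X i \<omega>" n] by simp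
  have d_le: "?d \<omega> \<le> E \<omega>" if \<omega>: "\<omega> \<in> space M" for \<omega>
  proof -
    have "\<exists>b\<in>grid_partitions k n. \<exists>l\<in>U \<rightarrow> {1..k}. \<exists>u\<in>U \<rightarrow> {0..n}. \<exists>v\<in>U \<rightarrow> {0..n}.
      real (LI (\<lambda>i. X i \<omega>) n) \<le> real (card {i \<in> {1..n}. X i \<omega> = c (segment b i)}) + (\<Sum>a\<in>U. D a (l a) (u a) (v a) \<omega>)"
      unfolding D_def using XA[OF _ \<omega>] by (intro LI_le_segment_matches k c U) (simp add: A_def)
    then obtain b l u v where b: "b \<in> grid_partitions k n" and luv: "l \<in> U \<rightarrow> {1..k}" "u \<in> U \<rightarrow> {0..n}" "v \<in> U \<rightarrow> {0..n}"
      and le: "real (LI (\<lambda>i. X i \<omega>) n) \<le> real (card {i \<in> {1..n}. X i \<omega> = c (segment b i)}) + (\<Sum>a\<in>U. D a (l a) (u a) (v a) \<omega>)"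
      by blast
    have "card {i \<in> {1..n}. X i \<omega> = c (segment b i)} \<le> segment_matches k c (\<lambda>i. X i \<omega>) n"
      unfolding segment_matches_def using b finite_grid_partitions by (intro Max_ge) auto
    then have "?d \<omega> \<le> (\<Sum>a\<in>U. D a (l a) (u a) (v a) \<omega>)"
      using le by linarith
    also have "\<dots> \<le> E \<omega>"
      unfolding E_def
    proof (rule sum_mono)
      fix a assume a: "a \<in> U"
      let ?e = "\<lambda>l u v. exp (- s) * exp (r a * D a l u v \<omega>)"
      have mem: "l a \<in> {1..k}" "u a \<in> {0..n}" "v a \<in> {0..n}" using luv a by auto
      have "?e (l a) (u a) (v a) \<le> (\<Sum>v\<in>{0..n}. ?e (l a) (u a) v)"
        using mem by (intro member_le_sum) auto
      also have "\<dots> \<le> (\<Sum>u\<in>{0..n}. \<Sum>v\<in>{0..n}. ?e (l a) u v)"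
        using mem by (intro member_le_sum[where f="\<lambda>u. \<Sum>v\<in>{0..n}. ?e (l a) u v"] sum_nonneg) auto
      also have "\<dots> \<le> (\<Sum>l\<in>{1..k}. \<Sum>u\<in>{0..n}. \<Sum>v\<in>{0..n}. ?e l u v)"
        using mem by (intro member_le_sum[where f="\<lambda>l. \<Sum>u\<in>{0..n}. \<Sum>v\<in>{0..n}. ?e l u v"] sum_nonneg) auto
      finally have "?e (l a) (u a) (v a) \<le> \<dots>" .
      moreover have "r a * D a (l a) (u a) (v a) \<omega> - s \<le> ?e (l a) (u a) (v a)"
      proof -
        have "?e (l a) (u a) (v a) = exp (r a * D a (l a) (u a) (v a) \<omega> - s)"
          by (simp flip: exp_add)
        then show ?thesis
          using exp_ge_add_one_self[of "r a * D a (l a) (u a) (v a) \<omega> - s"] by linarith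
      qed
      ultimately have "D a (l a) (u a) (v a) \<omega> * r a \<le> s + (\<Sum>l\<in>{1..k}. \<Sum>u\<in>{0..n}. \<Sum>v\<in>{0..n}. ?e l u v)"
        by (simp add: mult.commute)
      then show "D a (l a) (u a) (v a) \<omega> \<le> (s + (\<Sum>l\<in>{1..k}. \<Sum>u\<in>{0..n}. \<Sum>v\<in>{0..n}. ?e l u v)) / r a"
        using r[OF a] by (subst pos_le_divide_eq)
    qed
    finally show ?thesis .
  qed
  have d_meas: "?d \<in> borel_measurable M"
  proof (rule borel_measurable_finite_letters[OF A X])
    fix x y :: "nat \<Rightarrow> 'b" assume xy: "\<And>i. i \<in> {1..n} \<Longrightarrow> x i = y i"
    then have "{i \<in> {1..n}. x i = c (segment b i)} = {i \<in> {1..n}. y i = c (segment b i)}" for b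
      by auto
    then have "segment_matches k c x n = segment_matches k c y n"
      unfolding segment_matches_def by presburger
    then show "real (LI x n) - real (segment_matches k c x n) = real (LI y n) - real (segment_matches k c y n)"
      using LI_cong[OF xy] by simp
  qed
  show d_int: "integrable M ?d"
    using E_int d_meas
  proof (rule Bochner_Integration.integrable_bound)
    show "AE \<omega> in M. norm (?d \<omega>) \<le> norm (E \<omega>)"
      using nonneg d_le by (intro AE_I2) (force intro: order.trans[OF _ abs_ge_self])
  qed
  have "expectation ?d \<le> expectation E"
    using d_int E_int d_le by (rule integral_mono)
  then show "expectation ?d \<le> (2 * ln (real n + 1) + k) * (\<Sum>a\<in>U. 1 / ln (pmax / q a))"
    unfolding E_exp s_def r_def .
qed

text \<open>
  The normalised indicator vector of a letter. Taking \<open>s\<^sup>2 = n p (1 - p)\<close> gives it the covariance of a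
  Brownian increment over time \<open>1 / n\<close>.
\<close>
definition letter_step :: "nat \<Rightarrow> (nat \<Rightarrow> 'b) \<Rightarrow> real \<Rightarrow> real \<Rightarrow> 'b \<Rightarrow> nat \<Rightarrow> real" where
  "letter_step k c p s y = (\<lambda>l\<in>{1..k}. (of_bool (y = c l) - p) / s)"

lemma (in prob_space) letter_step_moments:
  assumes c: "inj_on c {1..k}" and l: "l \<in> {1..k}" and s: "0 < s" and p: "0 \<le> p" "p \<le> 1"
    and ev: "\<And>l. l \<in> {1..k} \<Longrightarrow> {\<omega> \<in> space M. Y \<omega> = c l} \<in> events"
    and Y: "\<And>l. l \<in> {1..k} \<Longrightarrow> prob {\<omega> \<in> space M. Y \<omega> = c l} = p"
  shows "expectation (\<lambda>\<omega>. letter_step k c p s (Y \<omega>) l) = 0"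
    and "l' \<in> {1..k} \<Longrightarrow> expectation (\<lambda>\<omega>. letter_step k c p s (Y \<omega>) l * letter_step k c p s (Y \<omega>) l')
      = (if l = l' then p * (1 - p) else - p\<^sup>2) / s\<^sup>2"
    and "integrable M (\<lambda>\<omega>. \<bar>letter_step k c p s (Y \<omega>) l\<bar> ^ 3)"
    and "expectation (\<lambda>\<omega>. \<bar>letter_step k c p s (Y \<omega>) l\<bar> ^ 3) \<le> (1 / s) ^ 3"
proof -
  let ?I = "\<lambda>l. indicator {\<omega> \<in> space M. Y \<omega> = c l} :: 'a \<Rightarrow> real"
  have step: "letter_step k c p s (Y \<omega>) l = (?I l \<omega> - p) / s" if "\<omega> \<in> space M" "l \<in> {1..k}" for l \<omega>
    using that by (simp add: letter_step_def indicator_def)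
  have I: "integrable M (?I l)" "expectation (?I l) = p" if "l \<in> {1..k}" for l
    using ev[OF that] Y[OF that] by (auto simp: emeasure_eq_measure less_top[symmetric] Int_absorb2 subset_iff)
  have "expectation (\<lambda>\<omega>. letter_step k c p s (Y \<omega>) l) = expectation (\<lambda>\<omega>. (?I l \<omega> - p) / s)"
    using step l by (intro Bochner_Integration.integral_cong) auto
  also have "\<dots> = 0" using I[OF l] by (simp add: prob_space)
  finally show "expectation (\<lambda>\<omega>. letter_step k c p s (Y \<omega>) l) = 0" .
  show "expectation (\<lambda>\<omega>. letter_step k c p s (Y \<omega>) l * letter_step k c p s (Y \<omega>) l')
      = (if l = l' then p * (1 - p) else - p\<^sup>2) / s\<^sup>2" if l': "l' \<in> {1..k}"
  proof -
    have "?I l \<omega> * ?I l' \<omega> = (if l = l' then ?I l \<omega> else 0)" for \<omega>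
      using inj_onD[OF c _ l l'] by (auto simp: indicator_def)
    then have "(?I l \<omega> - p) / s * ((?I l' \<omega> - p) / s) =
        ((if l = l' then ?I l \<omega> else 0) - p * ?I l \<omega> - p * ?I l' \<omega> + p\<^sup>2) / s\<^sup>2" for \<omega>
      by (simp add: algebra_simps power2_eq_square flip: add_divide_distrib diff_divide_distrib)
    then have "expectation (\<lambda>\<omega>. letter_step k c p s (Y \<omega>) l * letter_step k c p s (Y \<omega>) l') =
      expectation (\<lambda>\<omega>. ((if l = l' then ?I l \<omega> else 0) - p * ?I l \<omega> - p * ?I l' \<omega> + p\<^sup>2) / s\<^sup>2)"
      using step l l' by (intro Bochner_Integration.integral_cong) auto
    also have "\<dots> = ((if l = l' then p else 0) - p * p - p * p + p\<^sup>2) / s\<^sup>2"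
      using I[OF l] I[OF l'] by (cases "l = l'") (simp_all add: prob_space)
    also have "\<dots> = (if l = l' then p * (1 - p) else - p\<^sup>2) / s\<^sup>2"
      by (simp add: power2_eq_square algebra_simps)
    finally show ?thesis .
  qed
  have bound: "\<bar>(?I l \<omega> - p) / s\<bar> ^ 3 \<le> (1 / s) ^ 3" for \<omega>
    using p s by (intro power_mono) (auto simp: indicator_def abs_le_iff divide_right_mono)
  have "(\<lambda>\<omega>. \<bar>(?I l \<omega> - p) / s\<bar> ^ 3) \<in> borel_measurable M"
    using ev[OF l] by measurable
  then have int: "integrable M (\<lambda>\<omega>. \<bar>(?I l \<omega> - p) / s\<bar> ^ 3)"
    using bound s by (intro integrable_const_bound[where B="(1 / s) ^ 3"]) auto
  then show "integrable M (\<lambda>\<omega>. \<bar>letter_step k c p s (Y \<omega>) l\<bar> ^ 3)"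
    using step l by (subst Bochner_Integration.integrable_cong) auto
  have "expectation (\<lambda>\<omega>. \<bar>letter_step k c p s (Y \<omega>) l\<bar> ^ 3) = expectation (\<lambda>\<omega>. \<bar>(?I l \<omega> - p) / s\<bar> ^ 3)"
    using step l by (intro Bochner_Integration.integral_cong) auto
  also have "\<dots> \<le> expectation (\<lambda>\<omega>. (1 / s) ^ 3)"
    using int bound by (intro integral_mono) auto
  finally show "expectation (\<lambda>\<omega>. \<bar>letter_step k c p s (Y \<omega>) l\<bar> ^ 3) \<le> (1 / s) ^ 3"
    by (simp add: prob_space)
qed

lemma Max_path_letter_steps:
  assumes k: "1 \<le> k" and s: "0 < s"
  shows "Max ((\<lambda>b. \<Sum>i=1..n. letter_step k c p s (x i) (segment b i)) ` grid_partitions k n)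
    = (real (segment_matches k c x n) - p * real n) / s"
proof -
  have sum: "(\<Sum>i=1..n. letter_step k c p s (x i) (segment b i)) = (real (card {i \<in> {1..n}. x i = c (segment b i)}) - p * real n) / s"
    if "b \<in> grid_partitions k n" for b
  proof -
    have "(\<Sum>i=1..n. letter_step k c p s (x i) (segment b i)) = (\<Sum>i=1..n. (of_bool (x i = c (segment b i)) - p) / s)"
      using segment_in[OF that] by (intro sum.cong) (auto simp: letter_step_def)
    also have "\<dots> = ((\<Sum>i=1..n. of_bool (x i = c (segment b i))) - p * real n) / s"
      by (simp add: sum_subtractf mult.commute flip: sum_divide_distrib)
    also have "(\<Sum>i=1..n. of_bool (x i = c (segment b i))) = real (card {i \<in> {1..n}. x i = c (segment b i)})"
      by (simp add: Int_def)
    finally show ?thesis .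
  qed
  have "mono (\<lambda>v. (real v - p * real n) / s)"
    using s by (auto intro!: monoI divide_right_mono)
  then have "(real (segment_matches k c x n) - p * real n) / s =
      Max ((\<lambda>v. (real v - p * real n) / s) ` (\<lambda>b. card {i \<in> {1..n}. x i = c (segment b i)}) ` grid_partitions k n)"
    unfolding segment_matches_def using finite_grid_partitions grid_partitions_nonempty[OF k]
    by (intro mono_Max_commute) auto
  also have "\<dots> = Max ((\<lambda>b. \<Sum>i=1..n. letter_step k c p s (x i) (segment b i)) ` grid_partitions k n)"
    using sum by (intro arg_cong[where f=Max]) (auto simp: image_image)
  finally show ?thesis by simp
qed

section \<open>The Brownian functional\<close>

text \<open>
  Positive variance rules out the constant case of the definition of a Gaussian variable. For the normal
  law the third absolute moment is \<open>2 sqrt (2 / pi)\<close> times the cube of the standard deviation.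
\<close>
lemma centered_gaussian_third_moment:
  assumes "prob_space N" and gauss: "gaussian_rv N Y"
    and mean: "(LINT \<omega>|N. Y \<omega>) = 0" and var: "(LINT \<omega>|N. (Y \<omega>)\<^sup>2) = v" and v: "0 < v"
  shows "integrable N (\<lambda>\<omega>. \<bar>Y \<omega>\<bar> ^ 3)" and "(LINT \<omega>|N. \<bar>Y \<omega>\<bar> ^ 3) \<le> 2 * sqrt v ^ 3"
proof -
  interpret prob_space N by fact
  have Y[measurable]: "Y \<in> borel_measurable N" using gauss by (simp add: gaussian_rv_def)
  have law: "(LINT \<omega>|N. f (Y \<omega>)) = (LINT y|distr N borel Y. f y)" if "f \<in> borel_measurable borel"
    for f :: "real \<Rightarrow> real"
    using that by (simp add: integral_distr)
  have nondeg: "distr N borel Y \<noteq> return borel \<mu>" for \<mu>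
  proof
    assume eq: "distr N borel Y = return borel \<mu>"
    have "\<mu> = 0" using mean law[of "\<lambda>y. y"] by (simp add: eq integral_return)
    then have "v = 0" using var law[of "\<lambda>y. y\<^sup>2"] by (simp add: eq integral_return)
    then show False using v by simp
  qed
  then obtain \<mu> \<sigma> where \<sigma>: "0 < \<sigma>" and eq: "distr N borel Y = density lborel (normal_density \<mu> \<sigma>)"
    using gauss by (auto simp: gaussian_rv_def)
  have dens: "(LINT \<omega>|N. f (Y \<omega>)) = (LINT y|lborel. normal_density \<mu> \<sigma> y * f y)"
    if "f \<in> borel_measurable borel" for f :: "real \<Rightarrow> real"
    using that by (simp add: law eq integral_density)
  have \<mu>: "\<mu> = 0"
    using mean dens[of "\<lambda>y. y"] integral_normal_moment_nz_1[OF \<sigma>, of \<mu>] by simp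
  have "v = \<sigma>\<^sup>2"
    using var dens[of "\<lambda>y. y\<^sup>2"] integral_normal_moment_even[OF \<sigma>, of \<mu> 1] by (simp add: \<mu>)
  then have sv: "sqrt v = \<sigma>" using \<sigma> by simp
  have third: "has_bochner_integral lborel (\<lambda>y. normal_density \<mu> \<sigma> y * \<bar>y\<bar> ^ 3) (2 * \<sigma> ^ 3 * sqrt (2 / pi))"
    using normal_moment_abs_odd[OF \<sigma>, of \<mu> 1] by (simp add: \<mu> numeral_3_eq_3)
  have "integrable (distr N borel Y) (\<lambda>y. \<bar>y\<bar> ^ 3)"
    unfolding eq using third by (subst integrable_density) (auto simp: has_bochner_integral_iff)
  then show "integrable N (\<lambda>\<omega>. \<bar>Y \<omega>\<bar> ^ 3)"
    by (subst (asm) integrable_distr_eq) auto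
  have "sqrt (2 / pi) \<le> 1" using pi_gt3 by simp
  then have "2 * \<sigma> ^ 3 * sqrt (2 / pi) \<le> 2 * \<sigma> ^ 3 * 1"
    using \<sigma> by (intro mult_left_mono) auto
  then show "(LINT \<omega>|N. \<bar>Y \<omega>\<bar> ^ 3) \<le> 2 * sqrt v ^ 3"
    using dens[of "\<lambda>y. \<bar>y\<bar> ^ 3"] third by (simp add: has_bochner_integral_iff sv)
qed

lemma brownian_motion_gaussian:
  assumes bm: "brownian_motion N k C B" and l: "l \<in> {1..k}" and t: "t \<in> {0..1}"
  shows "gaussian_rv N (B l t)"
proof -
  have "gaussian_rv N (\<lambda>\<omega>. \<Sum>l'\<in>{1..k}. \<Sum>s\<in>{t}. of_bool (l' = l) * B l' s \<omega>)"
    using bm t unfolding brownian_motion_def by (elim conjE allE[of _ "{t}"] allE[of _ "\<lambda>l' s. of_bool (l' = l)"]) auto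
  also have "(\<lambda>\<omega>. \<Sum>l'\<in>{1..k}. \<Sum>s\<in>{t}. of_bool (l' = l) * B l' s \<omega>) = B l t"
    using l by (simp add: sum.delta of_bool_def if_distrib[of "\<lambda>u. u * _"] cong: if_cong)
  finally show ?thesis .
qed

definition brownian_step :: "nat \<Rightarrow> (nat \<Rightarrow> real \<Rightarrow> 'w \<Rightarrow> real) \<Rightarrow> nat \<Rightarrow> nat \<Rightarrow> 'w \<Rightarrow> nat \<Rightarrow> real" where
  "brownian_step k B n i = increment k B (real (i - 1) / real n) (real i / real n)"

lemma brownian_steps_iid:
  assumes bm: "brownian_motion N k C B" and n: "1 \<le> n"
  shows "prob_space.indep_vars N (\<lambda>_. \<Pi>\<^sub>M l\<in>{1..k}. borel) (brownian_step k B n) {1..n}"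
    and "i \<in> {1..n} \<Longrightarrow> distr N (\<Pi>\<^sub>M l\<in>{1..k}. borel) (brownian_step k B n i)
      = distr N (\<Pi>\<^sub>M l\<in>{1..k}. borel) (brownian_step k B n 1)"
proof -
  have "mono_on {0..n} (\<lambda>i. real i / real n)" "(\<lambda>i. real i / real n) ` {0..n} \<subseteq> {0..1}"
    using n by (auto simp: mono_on_def divide_right_mono)
  then show "prob_space.indep_vars N (\<lambda>_. \<Pi>\<^sub>M l\<in>{1..k}. borel) (brownian_step k B n) {1..n}"
    using bm unfolding brownian_motion_def brownian_step_def[abs_def] by blast
  have stat: "distr N (\<Pi>\<^sub>M l\<in>{1..k}. borel) (increment k B s (s + h)) =
        distr N (\<Pi>\<^sub>M l\<in>{1..k}. borel) (increment k B 0 h)" if "0 \<le> s" "0 \<le> h" "s + h \<le> 1" for s h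
    using bm that unfolding brownian_motion_def by blast
  assume i: "i \<in> {1..n}"
  then have i': "real (i - 1) / real n + 1 / real n = real i / real n"
    by (simp add: of_nat_diff flip: add_divide_distrib)
  have "distr N (\<Pi>\<^sub>M l\<in>{1..k}. borel) (increment k B (real (i - 1) / real n) (real (i - 1) / real n + 1 / real n)) =
        distr N (\<Pi>\<^sub>M l\<in>{1..k}. borel) (increment k B 0 (1 / real n))"
  proof (rule stat)
    show "real (i - 1) / real n + 1 / real n \<le> 1" unfolding i' using i n by simp
  qed simp_all
  then show "distr N (\<Pi>\<^sub>M l\<in>{1..k}. borel) (brownian_step k B n i)
      = distr N (\<Pi>\<^sub>M l\<in>{1..k}. borel) (brownian_step k B n 1)"
    unfolding i' brownian_step_def by simp
qed

lemma brownian_step_moments: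
  assumes bm: "brownian_motion N k C B" and n: "1 \<le> n" and l: "l \<in> {1..k}"
  shows "(LINT \<omega>|N. brownian_step k B n 1 \<omega> l) = 0"
    and "l' \<in> {1..k} \<Longrightarrow> (LINT \<omega>|N. brownian_step k B n 1 \<omega> l * brownian_step k B n 1 \<omega> l') = C l l' / n"
    and "C l l = 1 \<Longrightarrow> integrable N (\<lambda>\<omega>. \<bar>brownian_step k B n 1 \<omega> l\<bar> ^ 3)"
    and "C l l = 1 \<Longrightarrow> (LINT \<omega>|N. \<bar>brownian_step k B n 1 \<omega> l\<bar> ^ 3) \<le> 2 * (1 / sqrt n) ^ 3"
proof -
  have N: "prob_space N" and zero: "\<And>l \<omega>. l \<in> {1..k} \<Longrightarrow> \<omega> \<in> space N \<Longrightarrow> B l 0 \<omega> = 0"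
    and mean: "\<And>l t. l \<in> {1..k} \<Longrightarrow> t \<in> {0..1} \<Longrightarrow> (LINT \<omega>|N. B l t \<omega>) = 0"
    and cov: "\<And>l l' t. l \<in> {1..k} \<Longrightarrow> l' \<in> {1..k} \<Longrightarrow> t \<in> {0..1} \<Longrightarrow> covariance N (B l t) (B l' t) = t * C l l'"
    using bm unfolding brownian_motion_def by auto
  define h where "h = 1 / real n"
  have h: "h \<in> {0..1}" "0 < h" using n by (auto simp: h_def)
  have step: "brownian_step k B n 1 \<omega> l = B l h \<omega>" if "\<omega> \<in> space N" "l \<in> {1..k}" for \<omega> l
    using that zero by (simp add: brownian_step_def increment_def h_def)
  have int: "(LINT \<omega>|N. g (brownian_step k B n 1 \<omega> l)) = (LINT \<omega>|N. g (B l h \<omega>))" for g :: "real \<Rightarrow> real"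
    using step l by (intro Bochner_Integration.integral_cong) auto
  show "(LINT \<omega>|N. brownian_step k B n 1 \<omega> l) = 0"
    using int[of "\<lambda>y. y"] mean[OF l h(1)] by simp
  have second: "(LINT \<omega>|N. B l h \<omega> * B l' h \<omega>) = C l l' / n" if "l' \<in> {1..k}" for l'
    using cov[OF l that h(1)] mean[OF l h(1)] mean[OF that h(1)] by (simp add: covariance_def h_def)
  show "(LINT \<omega>|N. brownian_step k B n 1 \<omega> l * brownian_step k B n 1 \<omega> l') = C l l' / n" if "l' \<in> {1..k}"
    using step l that unfolding second[OF that, symmetric] by (intro Bochner_Integration.integral_cong) auto
  assume C: "C l l = 1"
  have "(LINT \<omega>|N. (B l h \<omega>)\<^sup>2) = h"
    using second[OF l] by (simp add: power2_eq_square C h_def)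
  note third = centered_gaussian_third_moment[OF N brownian_motion_gaussian[OF bm l h(1)] mean[OF l h(1)] this h(2)]
  show "integrable N (\<lambda>\<omega>. \<bar>brownian_step k B n 1 \<omega> l\<bar> ^ 3)"
    using third(1) step l by (subst Bochner_Integration.integrable_cong) auto
  show "(LINT \<omega>|N. \<bar>brownian_step k B n 1 \<omega> l\<bar> ^ 3) \<le> 2 * (1 / sqrt n) ^ 3"
    using third(2) unfolding int[of "\<lambda>y. \<bar>y\<bar> ^ 3"] by (simp add: h_def real_sqrt_divide)
qed

lemma sum_brownian_steps:
  assumes b: "b \<in> grid_partitions k n"
  shows "(\<Sum>i=1..n. brownian_step k B n i \<omega> (segment b i))
    = (\<Sum>l=1..k. B l (real (b l) / real n) \<omega> - B l (real (b (l - 1)) / real n) \<omega>)"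
  unfolding sum_by_segments[OF b, of "\<lambda>i. brownian_step k B n i \<omega>"]
proof (intro sum.cong refl)
  fix l assume l: "l \<in> {1..k}"
  have "b (l - 1) \<le> b l" using b l by (auto simp: grid_partitions_def mono_on_def)
  then show "(\<Sum>i\<in>{b (l - 1)<..b l}. brownian_step k B n i \<omega> l)
      = B l (real (b l) / real n) \<omega> - B l (real (b (l - 1)) / real n) \<omega>"
    using l sum_telescope''[of "b (l - 1)" "b l" "\<lambda>i. B l (real i / real n) \<omega>"]
    by (simp add: brownian_step_def increment_def atLeastSucAtMost_greaterThanAtMost)
qed

text \<open>
  Grid partitions rescale to partitions, which bounds the grid maximum by the supremum. Conversely,
  rounding down one maximising partition \<open>t\<close> to the grid gives values that converge to the supremum by
  continuity at the points \<open>t l\<close>.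
\<close>
lemma grid_max_tendsto_max_functional:
  fixes f :: "nat \<Rightarrow> real \<Rightarrow> real"
  assumes k: "1 \<le> k" and f: "\<And>l. l \<in> {1..k} \<Longrightarrow> continuous_on {0..1} (f l)"
  shows "(\<lambda>n. Max ((\<lambda>b. \<Sum>l=1..k. f l (real (b l) / real n) - f l (real (b (l - 1)) / real n)) ` grid_partitions k n))
    \<longlonglongrightarrow> max_functional k f"
proof -
  define F where "F s = (\<Sum>l=1..k. f l (s l) - f l (s (l - 1)))" for s :: "nat \<Rightarrow> real"
  have "\<exists>t\<in>partitions k. max_functional k f = F t \<and> (\<forall>s\<in>partitions k. F s \<le> F t)"
    unfolding F_def by (rule max_functional_attained[OF k f])
  then obtain t where t: "t \<in> partitions k" "max_functional k f = F t"
    and t_max: "\<And>s. s \<in> partitions k \<Longrightarrow> F s \<le> F t"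
    by blast
  have t0k: "t 0 = 0" "t k = 1" and t_mono: "\<And>l l'. l \<le> l' \<Longrightarrow> l' \<le> k \<Longrightarrow> t l \<le> t l'"
    using t(1) by (auto simp: partitions_def mono_on_def)
  have t01: "t l \<in> {0..1}" if "l \<le> k" for l
    using t_mono[of 0 l] t_mono[of l k] that t0k by auto
  define M where "M n = Max ((\<lambda>b. F (\<lambda>l. real (b l) / real n)) ` grid_partitions k n)" for n
  define b where "b n = (\<lambda>l\<in>{0..k}. nat \<lfloor>real n * t l\<rfloor>)" for n :: nat
  have b_grid: "b n \<in> grid_partitions k n" for n
  proof -
    have "nat \<lfloor>real n * t l\<rfloor> \<le> n" if "l \<le> k" for l
    proof -
      have "\<lfloor>real n * t l\<rfloor> \<le> \<lfloor>real n\<rfloor>"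
        using t01[OF that] by (intro floor_mono mult_left_le) auto
      then show ?thesis by simp
    qed
    moreover have "nat \<lfloor>real n * t l\<rfloor> \<le> nat \<lfloor>real n * t l'\<rfloor>" if "l \<le> l'" "l' \<le> k" for l l'
      using t_mono[OF that] by (intro nat_mono floor_mono mult_left_mono) auto
    ultimately show ?thesis
      by (auto simp: grid_partitions_def b_def mono_on_def t0k)
  qed
  have upper: "M n \<le> F t" if n: "1 \<le> n" for n
    unfolding M_def
  proof (intro Max.boundedI)
    fix y assume "y \<in> (\<lambda>b. F (\<lambda>l. real (b l) / real n)) ` grid_partitions k n"
    then obtain b where b: "b \<in> grid_partitions k n" and y: "y = F (\<lambda>l. real (b l) / real n)" by auto
    have "(\<lambda>l. real (b l) / real n) \<in> partitions k"
      using b n by (auto simp: grid_partitions_def partitions_def mono_on_def intro!: divide_right_mono)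
    then show "y \<le> F t" unfolding y by (rule t_max)
  qed (use finite_grid_partitions grid_partitions_nonempty[OF k] in auto)
  have lower: "F (\<lambda>l. real (b n l) / real n) \<le> M n" for n
    unfolding M_def using b_grid finite_grid_partitions by (intro Max_ge) auto
  have b_lim: "(\<lambda>n. real (b n l) / real n) \<longlonglongrightarrow> t l" if l: "l \<le> k" for l
  proof (rule tendsto_sandwich)
    have fl: "real (b n l) = of_int \<lfloor>real n * t l\<rfloor>" for n
      using l t01[OF l] by (simp add: b_def)
    show "\<forall>\<^sub>F n in sequentially. t l - 1 / real n \<le> real (b n l) / real n"
      using eventually_ge_at_top[of 1]
    proof eventually_elim
      case (elim n)
      have "real n * t l - 1 \<le> real (b n l)" unfolding fl by linarith
      moreover have n: "0 < real n" using elim by simp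
      then have "(t l - 1 / real n) * real n = real n * t l - 1" by (simp add: left_diff_distrib)
      ultimately show ?case by (simp only: pos_le_divide_eq[OF n])
    qed
    show "\<forall>\<^sub>F n in sequentially. real (b n l) / real n \<le> t l"
      using eventually_ge_at_top[of 1]
    proof eventually_elim
      case (elim n)
      have "real (b n l) \<le> real n * t l" unfolding fl by linarith
      then show ?case using elim by (simp add: field_simps)
    qed
    show "(\<lambda>n. t l - 1 / real n) \<longlonglongrightarrow> t l"
      using tendsto_diff[OF tendsto_const lim_1_over_n, of "t l"] by simp
  qed simp
  have b01: "real (b n l) / real n \<in> {0..1}" if "l \<le> k" for n l
  proof -
    have "b n l \<le> n" using b_grid[of n] that by (auto simp: grid_partitions_def PiE_iff)
    then show ?thesis by (cases "n = 0") auto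
  qed
  have f_lim: "(\<lambda>n. f l (real (b n l') / real n)) \<longlonglongrightarrow> f l (t l')" if "l \<in> {1..k}" "l' \<le> k" for l l'
    by (rule continuous_on_tendsto_compose[OF f[OF that(1)] b_lim[OF that(2)] t01[OF that(2)]])
      (rule always_eventually, rule allI, rule b01[OF that(2)])
  have F_lim: "(\<lambda>n. F (\<lambda>l. real (b n l) / real n)) \<longlonglongrightarrow> F t"
    unfolding F_def by (intro tendsto_sum tendsto_diff f_lim) auto
  have "M \<longlonglongrightarrow> F t"
  proof (rule tendsto_sandwich[OF _ _ F_lim tendsto_const])
    show "\<forall>\<^sub>F n in sequentially. F (\<lambda>l. real (b n l) / real n) \<le> M n"
      by (intro always_eventually allI lower)
    show "\<forall>\<^sub>F n in sequentially. M n \<le> F t"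
      using upper by (rule eventually_sequentiallyI)
  qed
  then show ?thesis unfolding M_def[abs_def] F_def t(2) .
qed

text \<open>
  As a pointwise limit of maxima over finitely many partitions, the functional is measurable although
  it is an uncountable supremum.
\<close>
lemma max_functional_brownian:
  fixes t c :: real
  assumes bm: "brownian_motion N k C B" and k: "1 \<le> k"
  shows max_functional_brownian_measurable: "(\<lambda>\<omega>. max_functional k (\<lambda>l t. B l t \<omega>)) \<in> borel_measurable N"
    and "(\<lambda>n. LINT \<omega>|N. sin (t * Max ((\<lambda>b. \<Sum>i=1..n. brownian_step k B n i \<omega> (segment b i)) ` grid_partitions k n) + c))
      \<longlonglongrightarrow> (LINT \<omega>|N. sin (t * max_functional k (\<lambda>l t. B l t \<omega>) + c))"
proof -
  interpret prob_space N using bm by (simp add: brownian_motion_def)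
  define H where "H n \<omega> = Max ((\<lambda>b. \<Sum>i=1..n. brownian_step k B n i \<omega> (segment b i)) ` grid_partitions k n)" for n \<omega>
  have H: "H n \<omega> = Max ((\<lambda>b. \<Sum>l=1..k. B l (real (b l) / real n) \<omega> - B l (real (b (l - 1)) / real n) \<omega>) ` grid_partitions k n)" for n \<omega>
    unfolding H_def by (intro arg_cong[where f=Max] image_cong refl sum_brownian_steps)
  have lim: "(\<lambda>n. H n \<omega>) \<longlonglongrightarrow> max_functional k (\<lambda>l t. B l t \<omega>)" if "\<omega> \<in> space N" for \<omega>
    unfolding H using bm that by (intro grid_max_tendsto_max_functional k) (auto simp: brownian_motion_def)
  have H_meas[measurable]: "H n \<in> borel_measurable N" for n
    unfolding H
  proof (intro borel_measurable_Max borel_measurable_sum borel_measurable_diff finite_grid_partitions)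
    fix b l assume b: "b \<in> grid_partitions k n" and l: "l \<in> {1..k}"
    have "b l' \<le> n" if "l' \<le> k" for l' using b that by (auto simp: grid_partitions_def PiE_iff)
    then have "real (b l') / real n \<in> {0..1}" if "l' \<le> k" for l'
      using that by (cases "n = 0") auto
    then show "B l (real (b l) / real n) \<in> borel_measurable N" "B l (real (b (l - 1)) / real n) \<in> borel_measurable N"
      using brownian_motion_gaussian[OF bm l] l by (auto simp: gaussian_rv_def)
  qed
  show meas[measurable]: "(\<lambda>\<omega>. max_functional k (\<lambda>l t. B l t \<omega>)) \<in> borel_measurable N"
  proof (rule borel_measurable_LIMSEQ_real[where u=H])
    show "(\<lambda>n. H n \<omega>) \<longlonglongrightarrow> max_functional k (\<lambda>l t. B l t \<omega>)" if "\<omega> \<in> space N" for \<omega>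
      using that by (rule lim)
    show "H n \<in> borel_measurable N" for n by (rule H_meas)
  qed
  have "(\<lambda>n. LINT \<omega>|N. sin (t * H n \<omega> + c)) \<longlonglongrightarrow> (LINT \<omega>|N. sin (t * max_functional k (\<lambda>l t. B l t \<omega>) + c))"
    using lim by (intro integral_dominated_convergence[where w="\<lambda>_. 1"]) (auto intro!: AE_I2 tendsto_intros)
  then show "(\<lambda>n. LINT \<omega>|N. sin (t * Max ((\<lambda>b. \<Sum>i=1..n. brownian_step k B n i \<omega> (segment b i)) ` grid_partitions k n) + c))
      \<longlonglongrightarrow> (LINT \<omega>|N. sin (t * max_functional k (\<lambda>l t. B l t \<omega>) + c))"
    unfolding H_def .
qed

section \<open>Weak convergence\<close>

lemma (in prob_space) char_distr_eq_sin:
  assumes Y: "Y \<in> borel_measurable M"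
  shows "char (distr M borel Y) t = Complex (expectation (\<lambda>\<omega>. sin (t * Y \<omega> + pi / 2))) (expectation (\<lambda>\<omega>. sin (t * Y \<omega> + 0)))"
proof -
  have "char (distr M borel Y) t = (CLINT \<omega>|M. iexp (t * Y \<omega>))"
    unfolding char_def using Y by (subst integral_distr) auto
  moreover have int: "complex_integrable M (\<lambda>\<omega>. iexp (t * Y \<omega>))"
    using Y by (intro integrable_const_bound[where B=1]) auto
  have "Re (CLINT \<omega>|M. iexp (t * Y \<omega>)) = expectation (\<lambda>\<omega>. sin (t * Y \<omega> + pi / 2))"
    unfolding integral_Re[OF int, symmetric] by (simp add: sin_add Re_exp)
  moreover have "Im (CLINT \<omega>|M. iexp (t * Y \<omega>)) = expectation (\<lambda>\<omega>. sin (t * Y \<omega> + 0))"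
    unfolding integral_Im[OF int, symmetric] by (simp add: Im_exp)
  ultimately show ?thesis by (simp add: complex_eq_iff)
qed

text \<open>
  The phase \<open>c\<close> covers both parts of the characteristic function: \<open>c = 0\<close> is the imaginary part and
  \<open>c = pi / 2\<close> the real part.
\<close>
lemma weak_conv_m_if_sin_expectations:
  assumes M: "prob_space M" and N: "prob_space N"
    and Y: "\<And>n. Y n \<in> borel_measurable M" and Z: "Z \<in> borel_measurable N"
    and conv: "\<And>t c. (\<lambda>n. LINT \<omega>|M. sin (t * Y n \<omega> + c)) \<longlonglongrightarrow> (LINT \<omega>|N. sin (t * Z \<omega> + c))"
  shows "weak_conv_m (\<lambda>n. distr M borel (Y n)) (distr N borel Z)"
proof (rule levy_continuity)
  interpret M: prob_space M by fact
  interpret N: prob_space N by fact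
  show "real_distribution (distr M borel (Y n))" for n using Y by (intro M.real_distribution_distr)
  show "real_distribution (distr N borel Z)" using Z by (intro N.real_distribution_distr)
  show "(\<lambda>n. char (distr M borel (Y n)) t) \<longlonglongrightarrow> char (distr N borel Z) t" for t
    unfolding M.char_distr_eq_sin[OF Y] N.char_distr_eq_sin[OF Z] by (intro tendsto_Complex conv)
qed

text \<open>
  The limit theorem with the alphabet split into the letters \<open>c 1 < \<dots> < c k\<close> of maximal probability and
  the set \<open>U\<close> of the others. The triangle inequality is applied twice, with \<open>first\<close> removing the
  letters in \<open>U\<close> and \<open>second\<close> passing from letters to Brownian increments.
\<close>
lemma weak_limit_LI:
  fixes M :: "'a measure" and X :: "nat \<Rightarrow> 'a \<Rightarrow> 'b::linorder" and c :: "nat \<Rightarrow> 'b"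
    and N :: "'w measure" and B :: "nat \<Rightarrow> real \<Rightarrow> 'w \<Rightarrow> real"
  assumes M: "prob_space M" and k: "1 \<le> k" and c: "strict_mono_on {1..k} c"
    and U: "finite U" "U \<inter> c ` {1..k} = {}"
    and indep: "prob_space.indep_vars M (\<lambda>_. count_space (c ` {1..k} \<union> U)) X {1..}"
    and ident: "\<And>i. i \<ge> 1 \<Longrightarrow>
      distr M (count_space (c ` {1..k} \<union> U)) (X i) = distr M (count_space (c ` {1..k} \<union> U)) (X 1)"
    and max: "\<And>l. l \<in> {1..k} \<Longrightarrow> measure M {\<omega> \<in> space M. X 1 \<omega> = c l} = pmax"
    and less: "\<And>a. a \<in> U \<Longrightarrow> measure M {\<omega> \<in> space M. X 1 \<omega> = a} = q a"
    and q: "\<And>a. a \<in> U \<Longrightarrow> 0 < q a \<and> q a < pmax"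
    and p: "0 < pmax" "pmax < 1"
    and bm: "brownian_motion N k (\<lambda>l l'. if l = l' then 1 else - pmax / (1 - pmax)) B"
  shows "weak_conv_m
           (\<lambda>n. distr M borel (\<lambda>\<omega>. (real (LI (\<lambda>i. X i \<omega>) n) - pmax * real n) / sqrt (real n)))
           (distr N borel (\<lambda>\<omega>. sqrt (pmax * (1 - pmax)) * max_functional k (\<lambda>l t. B l t \<omega>)))"
proof -
  interpret prob_space M by fact
  interpret N: prob_space N using bm by (simp add: brownian_motion_def)
  define A where "A = c ` {1..k} \<union> U"
  have A: "finite A" using U by (simp add: A_def)
  define \<sigma> where "\<sigma> = sqrt (pmax * (1 - pmax))"
  have \<sigma>: "0 < \<sigma>" "\<sigma>\<^sup>2 = pmax * (1 - pmax)" using p by (simp_all add: \<sigma>_def)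
  define Y where "Y n \<omega> = (real (LI (\<lambda>i. X i \<omega>) n) - pmax * real n) / sqrt (real n)" for n \<omega>
  define S where "S n \<omega> = real (segment_matches k c (\<lambda>i. X i \<omega>) n)" for n \<omega>
  define Z where "Z n \<omega> = Max ((\<lambda>b. \<Sum>i=1..n. brownian_step k B n i \<omega> (segment b i)) ` grid_partitions k n)" for n \<omega>
  have X: "random_variable (count_space A) (X i)" if "1 \<le> i" for i
    using indep that unfolding indep_vars_def2 A_def by auto
  have ev: "{\<omega> \<in> space M. X i \<omega> = a} \<in> events" and prob: "prob {\<omega> \<in> space M. X i \<omega> = a} = prob {\<omega> \<in> space M. X 1 \<omega> = a}"
    if "1 \<le> i" "a \<in> A" for i a
  proof -
    have eq: "X i' -` {a} \<inter> space M = {\<omega> \<in> space M. X i' \<omega> = a}" for i' by auto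
    have m: "X i' -` {a} \<inter> space M \<in> events" "measure (distr M (count_space A) (X i')) {a} = prob (X i' -` {a} \<inter> space M)" if "1 \<le> i'" for i'
      using measurable_sets[OF X[OF that], of "{a}"] measure_distr[OF X[OF that], of "{a}"] \<open>a \<in> A\<close> by auto
    show "{\<omega> \<in> space M. X i \<omega> = a} \<in> events" using m(1)[OF \<open>1 \<le> i\<close>] by (simp add: eq)
    show "prob {\<omega> \<in> space M. X i \<omega> = a} = prob {\<omega> \<in> space M. X 1 \<omega> = a}"
      using m(2)[OF \<open>1 \<le> i\<close>] m(2)[of 1] ident[OF \<open>1 \<le> i\<close>] unfolding A_def[symmetric] by (simp add: eq)
  qed
  have indep_n: "indep_vars (\<lambda>_. count_space A) X {1..n}" for n
    unfolding A_def using indep by (rule indep_vars_subset) auto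
  have LI_meas: "(\<lambda>\<omega>. real (LI (\<lambda>i. X i \<omega>) n)) \<in> borel_measurable M" for n
  proof (rule borel_measurable_finite_letters[OF A, where n=n and f="\<lambda>x. real (LI x n)"])
    show "random_variable (count_space A) (X i)" if "i \<in> {1..n}" for i using that by (intro X) simp
    show "real (LI x n) = real (LI y n)" if "\<And>i. i \<in> {1..n} \<Longrightarrow> x i = y i" for x y :: "nat \<Rightarrow> 'b"
      using LI_cong[OF that] by simp
  qed
  then have Y_meas: "Y n \<in> borel_measurable M" for n
    unfolding Y_def by measurable
  define \<Lambda> where "\<Lambda> = (\<Sum>a\<in>U. 1 / ln (pmax / q a))"
  have max_i: "prob {\<omega> \<in> space M. X i \<omega> = c l} = pmax" if "i \<in> {1..n}" "l \<in> {1..k}" for i l n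
    using prob[of i "c l"] max[OF that(2)] that by (simp add: A_def)
  have less_i: "prob {\<omega> \<in> space M. X i \<omega> = a} = q a" if "i \<in> {1..n}" "a \<in> U" for i a n
    using prob[of i a] less[OF that(2)] that by (simp add: A_def)
  have LI_S: "integrable M (\<lambda>\<omega>. real (LI (\<lambda>i. X i \<omega>) n) - S n \<omega>)"
    "expectation (\<lambda>\<omega>. real (LI (\<lambda>i. X i \<omega>) n) - S n \<omega>) \<le> (2 * ln (real n + 1) + k) * \<Lambda>" for n
    unfolding S_def \<Lambda>_def
    by (rule expectation_LI_minus_segment_matches[OF k c U indep_n[of n, unfolded A_def] p(1) max_i less_i q];
        assumption)+
  have sin_int: "integrable M (\<lambda>\<omega>. sin (t * f \<omega> + c0))" if "f \<in> borel_measurable M" for f :: "'a \<Rightarrow> real" and t c0 :: real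
  proof -
    have "(\<lambda>\<omega>. sin (t * f \<omega> + c0)) \<in> borel_measurable M" using that by measurable
    then show ?thesis by (intro integrable_const_bound[where B=1]) simp_all
  qed
  have first: "\<bar>expectation (\<lambda>\<omega>. sin (t * Y n \<omega> + c0)) - expectation (\<lambda>\<omega>. sin (t * ((S n \<omega> - pmax * real n) / sqrt n) + c0))\<bar>
      \<le> \<bar>t\<bar> * \<Lambda> * ((2 * ln (real n + 1) + k) / sqrt n)" for t c0 n
  proof -
    let ?d = "\<lambda>\<omega>. real (LI (\<lambda>i. X i \<omega>) n) - S n \<omega>"
    have "S n \<in> borel_measurable M"
      using borel_measurable_diff[OF LI_meas[of n] borel_measurable_integrable[OF LI_S(1)[of n]]] by simp
    then have "(\<lambda>\<omega>. (S n \<omega> - pmax * real n) / sqrt n) \<in> borel_measurable M"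
      by measurable
    note ints = sin_int[OF Y_meas[of n], of t c0] sin_int[OF this, of t c0]
    have pt: "\<bar>sin (t * Y n \<omega> + c0) - sin (t * ((S n \<omega> - pmax * real n) / sqrt n) + c0)\<bar> \<le> \<bar>t\<bar> / sqrt n * ?d \<omega>" for \<omega>
    proof -
      have "0 \<le> ?d \<omega>" using segment_matches_le_LI[OF k c, of "\<lambda>i. X i \<omega>" n] by (simp add: S_def)
      moreover have "(t * Y n \<omega> + c0) - (t * ((S n \<omega> - pmax * real n) / sqrt n) + c0) = t * ?d \<omega> / sqrt n"
        by (simp add: Y_def algebra_simps diff_divide_distrib)
      ultimately show ?thesis
        using abs_sin_diff_le[of "t * Y n \<omega> + c0" "t * ((S n \<omega> - pmax * real n) / sqrt n) + c0"]
        by (simp add: abs_mult)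
    qed
    have dom: "integrable M (\<lambda>\<omega>. \<bar>t\<bar> / sqrt n * ?d \<omega>)"
      using LI_S(1)[of n] by (rule integrable_mult_right)
    have "expectation (\<lambda>\<omega>. sin (t * Y n \<omega> + c0)) - expectation (\<lambda>\<omega>. sin (t * ((S n \<omega> - pmax * real n) / sqrt n) + c0))
      = expectation (\<lambda>\<omega>. sin (t * Y n \<omega> + c0) - sin (t * ((S n \<omega> - pmax * real n) / sqrt n) + c0))"
      using ints by simp
    also have "\<bar>\<dots>\<bar> \<le> expectation (\<lambda>\<omega>. \<bar>t\<bar> / sqrt n * ?d \<omega>)"
      by (rule order.trans[OF integral_abs_bound integral_mono[OF integrable_abs dom pt]])
        (rule Bochner_Integration.integrable_diff[OF ints])
    also have "\<dots> = \<bar>t\<bar> / sqrt n * expectation ?d" by simp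
    also have "\<dots> \<le> \<bar>t\<bar> / sqrt n * ((2 * ln (real n + 1) + k) * \<Lambda>)"
      by (intro mult_left_mono LI_S(2)) simp
    finally show ?thesis by (simp add: mult_ac)
  qed
  define K where "K t \<beta> = \<bar>t\<bar> * \<beta>\<^sup>2 + t\<^sup>2 * \<beta> + \<bar>t\<bar> ^ 3" for t \<beta> :: real
  define \<kappa> where "\<kappa> = k * ((1 / \<sigma>) ^ 3 + 2)"
  have second: "\<bar>expectation (\<lambda>\<omega>. sin (t * ((S n \<omega> - pmax * real n) / (\<sigma> * sqrt n)) + c0)) - N.expectation (\<lambda>\<omega>. sin (t * Z n \<omega> + c0))\<bar>
      \<le> 2 * \<bar>t\<bar> * ((k + 1) * ln (real n + 1)) / \<beta> + real n * (K t \<beta> * (\<kappa> * (1 / sqrt n) ^ 3))"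
    if n: "1 \<le> n" and \<beta>: "0 < \<beta>" for t c0 \<beta> n
  proof -
    define s where "s = \<sigma> * sqrt n"
    have s: "0 < s" "s\<^sup>2 = pmax * (1 - pmax) * n" using \<sigma> n by (simp_all add: s_def power_mult_distrib)
    let ?S = "\<Pi>\<^sub>M l\<in>{1..k}. (borel :: real measure)"
    define V where "V i \<omega> = letter_step k c pmax s (X i \<omega>)" for i \<omega>
    have g: "letter_step k c pmax s \<in> measurable (count_space A) ?S"
      by (auto simp: letter_step_def space_PiM)
    have V_indep: "indep_vars (\<lambda>_. ?S) V {1..n}"
      unfolding V_def[abs_def] using indep_n by (rule indep_vars_compose2) (rule g)
    have V_law: "distr M ?S (V i) = distr M ?S (V 1)" if "i \<in> {1..n}" for i
    proof -
      have "distr M ?S (V i) = distr (distr M (count_space A) (X i)) ?S (letter_step k c pmax s)" if "1 \<le> i" for i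
        using distr_distr[OF g X[OF that]] by (simp add: V_def[abs_def] comp_def)
      then show ?thesis using that ident[of i] unfolding A_def[symmetric] by simp
    qed
    have inj: "inj_on c {1..k}" using c by (rule strict_mono_on_imp_inj_on)
    have "expectation (\<lambda>\<omega>. V 1 \<omega> l) = 0"
      "l' \<in> {1..k} \<Longrightarrow> expectation (\<lambda>\<omega>. V 1 \<omega> l * V 1 \<omega> l') = (if l = l' then pmax * (1 - pmax) else - pmax\<^sup>2) / s\<^sup>2"
      "integrable M (\<lambda>\<omega>. \<bar>V 1 \<omega> l\<bar> ^ 3)" "expectation (\<lambda>\<omega>. \<bar>V 1 \<omega> l\<bar> ^ 3) \<le> (1 / s) ^ 3"
      if "l \<in> {1..k}" for l l'
      unfolding V_def using p ev[of 1] max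
      by (intro letter_step_moments[OF inj that s(1)]; simp add: A_def)+
    note V_mom = this
    let ?W = "brownian_step k B n"
    note W_mom = brownian_step_moments[OF bm n]
    have cov: "(if l = l' then pmax * (1 - pmax) else - pmax\<^sup>2) / s\<^sup>2 = (if l = l' then 1 else - pmax / (1 - pmax)) / n" for l l' :: nat
      unfolding s(2) using p n by (simp add: field_simps power2_eq_square)
    have maxV: "Max ((\<lambda>b. \<Sum>i=1..n. V i \<omega> (segment b i)) ` grid_partitions k n) = (S n \<omega> - pmax * real n) / (\<sigma> * sqrt n)" for \<omega>
      using Max_path_letter_steps[OF k s(1), where c=c and p=pmax and x="\<lambda>i. X i \<omega>" and n=n] unfolding V_def S_def s_def .
    have "\<bar>expectation (\<lambda>\<omega>. sin (t * Max ((\<lambda>b. \<Sum>i=1..n. V i \<omega> (segment b i)) ` grid_partitions k n) + c0)) -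
        N.expectation (\<lambda>\<omega>. sin (t * Max ((\<lambda>b. \<Sum>i=1..n. ?W i \<omega> (segment b i)) ` grid_partitions k n) + c0))\<bar>
      \<le> 2 * \<bar>t\<bar> * ln (card (grid_partitions k n)) / \<beta> + real n * ((\<bar>t\<bar> * \<beta>\<^sup>2 + t\<^sup>2 * \<beta> + \<bar>t\<bar> ^ 3) * (\<kappa> * (1 / sqrt n) ^ 3))"
    proof (rule max_path_comparison[where L="{1..k}"])
      show "distr N ?S (?W i) = distr N ?S (?W 1)" if "i \<in> {1..n}" for i
        using brownian_steps_iid(2)[OF bm n that] .
      show "expectation (\<lambda>\<omega>. V 1 \<omega> l) = N.expectation (\<lambda>\<omega>. ?W 1 \<omega> l)" if "l \<in> {1..k}" for l
        unfolding V_mom(1)[OF that] W_mom(1)[OF that] ..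
      show "expectation (\<lambda>\<omega>. V 1 \<omega> l * V 1 \<omega> l') = N.expectation (\<lambda>\<omega>. ?W 1 \<omega> l * ?W 1 \<omega> l')"
        if "l \<in> {1..k}" "l' \<in> {1..k}" for l l'
        unfolding V_mom(2)[OF that] W_mom(2)[OF that] by (rule cov)
      show "integrable N (\<lambda>\<omega>. \<bar>?W 1 \<omega> l\<bar> ^ 3)" if "l \<in> {1..k}" for l
        by (rule W_mom(3)[OF that]) simp
      have "(\<Sum>l\<in>{1..k}. expectation (\<lambda>\<omega>. \<bar>V 1 \<omega> l\<bar> ^ 3)) \<le> (\<Sum>l\<in>{1..k}. (1 / s) ^ 3)"
        by (intro sum_mono V_mom(4))
      moreover have "(\<Sum>l\<in>{1..k}. N.expectation (\<lambda>\<omega>. \<bar>?W 1 \<omega> l\<bar> ^ 3)) \<le> (\<Sum>l\<in>{1..k}. 2 * (1 / sqrt n) ^ 3)"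
        by (intro sum_mono W_mom(4)) simp_all
      moreover have "(\<Sum>l\<in>{1..k}. (1 / s) ^ 3) + (\<Sum>l\<in>{1..k}. 2 * (1 / sqrt n) ^ 3) = \<kappa> * (1 / sqrt n) ^ 3"
        by (simp add: \<kappa>_def s_def power_divide power_mult_distrib distrib_left distrib_right add_divide_distrib)
      ultimately show "(\<Sum>l\<in>{1..k}. expectation (\<lambda>\<omega>. \<bar>V 1 \<omega> l\<bar> ^ 3)) + (\<Sum>l\<in>{1..k}. N.expectation (\<lambda>\<omega>. \<bar>?W 1 \<omega> l\<bar> ^ 3))
          \<le> \<kappa> * (1 / sqrt n) ^ 3"
        by linarith
    qed (fact M N.prob_space_axioms n V_indep V_law brownian_steps_iid(1)[OF bm n] V_mom(3) \<beta> finite_grid_partitions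
        grid_partitions_nonempty[OF k] segment_in finite_atLeastAtMost)+
    also have "2 * \<bar>t\<bar> * ln (card (grid_partitions k n)) / \<beta> \<le> 2 * \<bar>t\<bar> * ((k + 1) * ln (real n + 1)) / \<beta>"
    proof -
      have "real (card (grid_partitions k n)) \<le> (real n + 1) ^ (k + 1)"
        using of_nat_mono[OF card_grid_partitions_le[of k n], where ?'a=real] by (simp add: algebra_simps)
      moreover have "0 < real (card (grid_partitions k n))"
        using finite_grid_partitions grid_partitions_nonempty[OF k] by (simp add: card_gt_0_iff)
      ultimately have "ln (card (grid_partitions k n)) \<le> ln ((real n + 1) ^ (k + 1))"
        by simp
      also have "\<dots> = (k + 1) * ln (real n + 1)" by (subst ln_realpow) simp_all
      finally show ?thesis using \<beta> by (intro divide_right_mono mult_left_mono) auto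
    qed
    finally show ?thesis unfolding maxV K_def Z_def by simp
  qed
  have "(\<lambda>n. expectation (\<lambda>\<omega>. sin (t * Y n \<omega> + c0))) \<longlonglongrightarrow>
    N.expectation (\<lambda>\<omega>. sin (t * (\<sigma> * max_functional k (\<lambda>l t. B l t \<omega>)) + c0))" for t c0
  proof -
    define t' where "t' = t * \<sigma>"
    \<comment> \<open>Any power of \<open>n\<close> with an exponent strictly between \<open>0\<close> and \<open>1 / 4\<close> would do: \<open>ln n / \<beta> n\<close> and
      \<open>(\<beta> n)\<^sup>2 / sqrt n\<close> must both vanish.\<close>
    define \<beta> where "\<beta> n = real n powr (1/8)" for n :: nat
    define err where "err n = \<bar>t\<bar> * \<Lambda> * ((2 * ln (real n + 1) + k) / sqrt n) +
      (2 * \<bar>t'\<bar> * ((k + 1) * ln (real n + 1)) / \<beta> n + real n * (K t' (\<beta> n) * (\<kappa> * (1 / sqrt n) ^ 3)))" for n :: nat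
    have err_lim: "err \<longlonglongrightarrow> 0"
    proof -
      have 1: "(\<lambda>n::nat. (2 * ln (real n + 1) + real k) / sqrt n) \<longlonglongrightarrow> 0" by real_asymp
      have 2: "(\<lambda>n::nat. ln (real n + 1) / \<beta> n) \<longlonglongrightarrow> 0" unfolding \<beta>_def by real_asymp
      have 3: "(\<lambda>n::nat. real n * (\<beta> n)\<^sup>2 * (1 / sqrt n) ^ 3) \<longlonglongrightarrow> 0" unfolding \<beta>_def by real_asymp
      have 4: "(\<lambda>n::nat. real n * \<beta> n * (1 / sqrt n) ^ 3) \<longlonglongrightarrow> 0" unfolding \<beta>_def by real_asymp
      have 5: "(\<lambda>n::nat. real n * (1 / sqrt n) ^ 3) \<longlonglongrightarrow> 0" by real_asymp
      have "err = (\<lambda>n. \<bar>t\<bar> * \<Lambda> * ((2 * ln (real n + 1) + k) / sqrt n) + (2 * \<bar>t'\<bar> * (k + 1) * (ln (real n + 1) / \<beta> n) +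
          (\<bar>t'\<bar> * \<kappa> * (real n * (\<beta> n)\<^sup>2 * (1 / sqrt n) ^ 3) + t'\<^sup>2 * \<kappa> * (real n * \<beta> n * (1 / sqrt n) ^ 3)
            + \<bar>t'\<bar> ^ 3 * \<kappa> * (real n * (1 / sqrt n) ^ 3))))"
        (is "err = ?e")
      proof
        fix n
        have "2 * \<bar>t'\<bar> * ((k + 1) * ln (real n + 1)) / \<beta> n = 2 * \<bar>t'\<bar> * (k + 1) * (ln (real n + 1) / \<beta> n)"
          by (simp add: mult.assoc)
        moreover have "real n * (K t' (\<beta> n) * (\<kappa> * w)) = \<bar>t'\<bar> * \<kappa> * (real n * (\<beta> n)\<^sup>2 * w)
            + t'\<^sup>2 * \<kappa> * (real n * \<beta> n * w) + \<bar>t'\<bar> ^ 3 * \<kappa> * (real n * w)" for w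
          unfolding K_def by algebra
        ultimately show "err n = ?e n" unfolding err_def by (simp only:)
      qed
      then show ?thesis
        by (simp only:, intro tendsto_add_zero tendsto_mult_right_zero 1 2 3 4 5)
    qed
    have close: "\<bar>expectation (\<lambda>\<omega>. sin (t * Y n \<omega> + c0)) - N.expectation (\<lambda>\<omega>. sin (t' * Z n \<omega> + c0))\<bar> \<le> err n" if n: "1 \<le> n" for n
    proof -
      have scale: "t' * ((S n \<omega> - pmax * real n) / (\<sigma> * sqrt n)) = t * ((S n \<omega> - pmax * real n) / sqrt n)" for \<omega>
        using \<sigma>(1) by (simp add: t'_def)
      have "0 < \<beta> n" using n by (simp add: \<beta>_def)
      from second[OF n this, of t' c0, unfolded scale] first[of t n c0]
      show ?thesis unfolding err_def by linarith
    qed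
    have "(\<lambda>n. expectation (\<lambda>\<omega>. sin (t * Y n \<omega> + c0)) - N.expectation (\<lambda>\<omega>. sin (t' * Z n \<omega> + c0))) \<longlonglongrightarrow> 0"
    proof (rule Lim_null_comparison[OF _ err_lim])
      show "\<forall>\<^sub>F n in sequentially. norm (expectation (\<lambda>\<omega>. sin (t * Y n \<omega> + c0)) - N.expectation (\<lambda>\<omega>. sin (t' * Z n \<omega> + c0))) \<le> err n"
        unfolding real_norm_def using close by (rule eventually_sequentiallyI)
    qed
    moreover have "(\<lambda>n. N.expectation (\<lambda>\<omega>. sin (t' * Z n \<omega> + c0))) \<longlonglongrightarrow>
        N.expectation (\<lambda>\<omega>. sin (t' * max_functional k (\<lambda>l t. B l t \<omega>) + c0))"
      unfolding Z_def by (rule max_functional_brownian(2)[OF bm k])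
    ultimately have "(\<lambda>n. (expectation (\<lambda>\<omega>. sin (t * Y n \<omega> + c0)) - N.expectation (\<lambda>\<omega>. sin (t' * Z n \<omega> + c0)))
        + N.expectation (\<lambda>\<omega>. sin (t' * Z n \<omega> + c0))) \<longlonglongrightarrow>
        0 + N.expectation (\<lambda>\<omega>. sin (t' * max_functional k (\<lambda>l t. B l t \<omega>) + c0))"
      by (rule tendsto_add)
    then show ?thesis by (simp add: t'_def mult.assoc)
  qed
  then have "weak_conv_m (\<lambda>n. distr M borel (Y n)) (distr N borel (\<lambda>\<omega>. \<sigma> * max_functional k (\<lambda>l t. B l t \<omega>)))"
    using M N.prob_space_axioms Y_meas max_functional_brownian_measurable[OF bm k]
    by (intro weak_conv_m_if_sin_expectations borel_measurable_times borel_measurable_const)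
  then show ?thesis
    unfolding Y_def[abs_def] \<sigma>_def .
qed

theorem corollary3p2:
  fixes M :: "'a measure" and X :: "nat \<Rightarrow> 'a \<Rightarrow> 'b::linorder"
    and m k :: nat and \<alpha> :: "nat \<Rightarrow> 'b" and p :: "nat \<Rightarrow> real" and pmax :: real
    and j :: "nat \<Rightarrow> nat"
    and N :: "'w measure" and B :: "nat \<Rightarrow> real \<Rightarrow> 'w \<Rightarrow> real"
  assumes "prob_space M"
    and "strict_mono_on {1..m} \<alpha>"
    and "prob_space.indep_vars M (\<lambda>_. count_space (\<alpha> ` {1..m})) X {1..}"
    and "\<And>i. i \<ge> 1 \<Longrightarrow>
           distr M (count_space (\<alpha> ` {1..m})) (X i) = distr M (count_space (\<alpha> ` {1..m})) (X 1)"
    and "\<And>r. r \<in> {1..m} \<Longrightarrow> measure M {\<omega> \<in> space M. X 1 \<omega> = \<alpha> r} = p r"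
    and "\<And>r. r \<in> {1..m} \<Longrightarrow> 0 < p r \<and> p r < 1"
    and "(\<Sum>r=1..m. p r) = 1"
    and "pmax = Max (p ` {1..m})"
    and "1 \<le> k" and "k \<le> m - 1"
    and "strict_mono_on {1..k} j" and "j ` {1..k} \<subseteq> {1..m}"
    and "\<And>l. l \<in> {1..k} \<Longrightarrow> p (j l) = pmax"
    and "\<And>i. i \<in> {1..m} - j ` {1..k} \<Longrightarrow> p i < pmax"
    and "brownian_motion N k (\<lambda>l l'. if l = l' then 1 else - pmax / (1 - pmax)) B"
  shows "weak_conv_m
           (\<lambda>n. distr M borel (\<lambda>\<omega>. (real (LI (\<lambda>i. X i \<omega>) n) - pmax * real n) / sqrt (real n)))
           (distr N borel (\<lambda>\<omega>. sqrt (pmax * (1 - pmax)) * max_functional k (\<lambda>l t. B l t \<omega>)))"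
proof -
  define c where "c l = \<alpha> (j l)" for l
  define U where "U = \<alpha> ` ({1..m} - j ` {1..k})"
  have \<alpha>: "inj_on \<alpha> {1..m}" using assms(2) by (rule strict_mono_on_imp_inj_on)
  have j: "j l \<in> {1..m}" if "l \<in> {1..k}" for l using subsetD[OF assms(12) imageI[OF that]] .
  have letters: "\<alpha> ` {1..m} = c ` {1..k} \<union> U"
    using assms(12) by (auto simp: c_def U_def)
  define q where "q a = measure M {\<omega> \<in> space M. X 1 \<omega> = a}" for a
  have q: "q (\<alpha> r) = p r" if "r \<in> {1..m}" for r using assms(5)[OF that] by (simp add: q_def)
  have pmax: "0 < pmax" "pmax < 1"
    using assms(6)[OF j[of 1]] assms(13)[of 1] \<open>1 \<le> k\<close> by auto
  show ?thesis
  proof (rule weak_limit_LI[where c=c and U=U and q=q])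
    show "strict_mono_on {1..k} c"
      using assms(2,11) j by (auto simp: c_def strict_mono_on_def)
    show "U \<inter> c ` {1..k} = {}"
    proof (rule equals0I)
      fix a assume "a \<in> U \<inter> c ` {1..k}"
      then obtain r l where "r \<in> {1..m}" "r \<notin> j ` {1..k}" "l \<in> {1..k}" "\<alpha> r = \<alpha> (j l)"
        by (auto simp: U_def c_def)
      then show False using inj_onD[OF \<alpha>, of r "j l"] j[of l] by blast
    qed
    show "measure M {\<omega> \<in> space M. X 1 \<omega> = c l} = pmax" if "l \<in> {1..k}" for l
      using q[OF j[OF that]] assms(13)[OF that] by (simp add: c_def q_def)
    show "0 < q a \<and> q a < pmax" if "a \<in> U" for a
      using that q assms(6,14) by (auto simp: U_def)
    show "prob_space.indep_vars M (\<lambda>_. count_space (c ` {1..k} \<union> U)) X {1..}"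
      using assms(3) unfolding letters .
    show "distr M (count_space (c ` {1..k} \<union> U)) (X i) = distr M (count_space (c ` {1..k} \<union> U)) (X 1)"
      if "1 \<le> i" for i
      using assms(4)[OF that] unfolding letters .
    show "finite U" by (simp add: U_def)
    show "measure M {\<omega> \<in> space M. X 1 \<omega> = a} = q a" for a by (simp add: q_def)
  qed (fact assms(1) assms(9) assms(15) pmax)+
qed

end
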